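(* Let $W$ be the Coxeter group of type $B_n$. Every conjugacy class of $W$ contains an element $w_{\lambda,\rho}$, where $\lambda$ is a maximal split partition of $n$ with respect to $\rho$. Furthermore, for every maximal split partition $\lambda$ of $n$ with respect to $\rho$, the element $w_{\lambda,\rho}$ has maximal $B$-length and maximal $D$-length in its conjugacy class of $W$; that is, $l_B(w_{\lambda,\rho})\ge l_B(v)$ and $l_D(w_{\lambda,\rho})\ge l_D(v)$ for all $v$ in the $W$-conjugacy class of $w_{\lambda,\rho}$.
   Context: $W$ is the group of signed permutations, i.e. the linear maps of $\mathbb{R}^n$ (acting on the left) permuting $\{\pm e_1,\dots,\pm e_n\}$, where $e_1,\dots,e_n$ is the standard basis. Elements are written as products of disjoint signed cycles: in a signed cycle, if $j$ follows $i$ cyclically, then $e_i\mapsto e_j$ if the entry is $\overset{+}{i}$ and $e_i\mapsto -e_j$ if the entry is $\overset{-}{i}$ (e.g. $(\overset{-}{1}\,\overset{+}{3}\,\overset{+}{8})$ sends $e_1\mapsto -e_3$, $e_3\mapsto e_8$, $e_8\mapsto e_1$). The positive long roots are $\Phi_{\mathrm{long}}^+=\{e_i\pm e_j: 1\le i<j\le n\}$, the positive short roots are $\Phi_{\mathrm{short}}^+=\{e_i:1\le i\le n\}$, $\Phi^+=\Phi_{\mathrm{long}}^+\cup\Phi_{\mathrm{short}}^+$ and $\Phi^-=-\Phi^+$. For $w\in W$ put $\Lambda(w)=\{\alpha\in\Phi_{\mathrm{long}}^+: w(\alpha)\in\Phi^-\}$ and $\Sigma(w)=\{\alpha\in\Phi_{\mathrm{short}}^+: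 w(\alpha)\in\Phi^-\}$. The $B$-length is $l_B(w)=|\Lambda(w)|+|\Sigma(w)|$ (the Coxeter length in $W$) and the $D$-length is $l_D(w)=|\Lambda(w)|$, defined for all $w\in W$ (for $w$ in the canonical index 2 subgroup $\hat W$ of type $D_n$, consisting of the elements with an even number of sign changes, it is the Coxeter length in $\hat W$). Let $\lambda=(\lambda_1,\dots,\lambda_m)$ be a partition of $n$, meaning here a sequence of positive integers with sum $n$ (not required to be monotone), and let $0\le\rho\le m$. Put $\mu_i=\sum_{j=1}^{i-1}\lambda_j$ (so $\mu_1=0$). Define $w_{\lambda,\rho}=w_1\cdots w_m$ where $w_i=(\overset{-}{\mu_i+1},\overset{-}{\mu_i+2},\dots,\overset{-}{\mu_{i+1}-1},\overset{-}{\mu_{i+1}})$ if $1\le i\le\rho$, and $w_i=(\overset{-}{\mu_i+1},\overset{-}{\mu_i+2},\dots,\overset{-}{\mu_{i+1}-1},\overset{+}{\mu_{i+1}})$ if $\rho<i\le m$. The sequence $\lambda$ is a maximal split partition with respect to $\rho$ if $\lambda_1\ge\cdots\ge\lambda_\rho$ and $\lambda_{\rho+1}\ge\cdots\ge\lambda_m$. *)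

theory Defs
  imports "HOL-Algebra.Group_Action" "Jordan_Normal_Form.Determinant"
begin

text \<open>Linear maps of \<open>\<real>\<^sup>n\<close> are represented by their matrices with respect to the standard basis,
  which acts on column vectors from the left via \<open>*\<^sub>v\<close>. The library numbers coordinates from \<open>0\<close>;
  the basis vectors below are numbered from \<open>1\<close> to \<open>n\<close>.\<close>

definition std_basis :: "nat \<Rightarrow> nat \<Rightarrow> real vec" where
  "std_basis n i = unit_vec n (i - 1)"

definition signed_basis :: "nat \<Rightarrow> real vec set" where
  "signed_basis n = std_basis n ` {1..n} \<union> (\<lambda>i. - std_basis n i) ` {1..n}"

definition type_B :: "nat \<Rightarrow> real mat monoid" where
  "type_B n =
    \<lparr>carrier = {A \<in> carrier_mat n n. bij_betw (\<lambda>v. A *\<^sub>v v) (signed_basis n) (signed_basis n)},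
     monoid.mult = (*), one = 1\<^sub>m n\<rparr>"

definition conj_action :: "nat \<Rightarrow> real mat \<Rightarrow> real mat \<Rightarrow> real mat" where
  "conj_action n g h = g \<otimes>\<^bsub>type_B n\<^esub> h \<otimes>\<^bsub>type_B n\<^esub> inv\<^bsub>type_B n\<^esub> g"

definition conj_class :: "nat \<Rightarrow> real mat \<Rightarrow> real mat set" where
  "conj_class n w = orbit (type_B n) (conj_action n) w"

definition conj_classes :: "nat \<Rightarrow> real mat set set" where
  "conj_classes n = orbits (type_B n) (carrier (type_B n)) (conj_action n)"

definition pos_long_roots :: "nat \<Rightarrow> real vec set" where
  "pos_long_roots n =
    {std_basis n i + std_basis n j | i j. 1 \<le> i \<and> i < j \<and> j \<le> n} \<union>
    {std_basis n i - std_basis n j | i j. 1 \<le> i \<and> i < j \<and> j \<le> n}"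

definition pos_short_roots :: "nat \<Rightarrow> real vec set" where
  "pos_short_roots n = {std_basis n i | i. 1 \<le> i \<and> i \<le> n}"

definition pos_roots :: "nat \<Rightarrow> real vec set" where
  "pos_roots n = pos_long_roots n \<union> pos_short_roots n"

definition neg_roots :: "nat \<Rightarrow> real vec set" where
  "neg_roots n = uminus ` pos_roots n"

definition Lambda :: "nat \<Rightarrow> real mat \<Rightarrow> real vec set" where
  "Lambda n w = {\<alpha> \<in> pos_long_roots n. w *\<^sub>v \<alpha> \<in> neg_roots n}"

definition Sigma_short :: "nat \<Rightarrow> real mat \<Rightarrow> real vec set" where
  "Sigma_short n w = {\<alpha> \<in> pos_short_roots n. w *\<^sub>v \<alpha> \<in> neg_roots n}"

definition B_length :: "nat \<Rightarrow> real mat \<Rightarrow> nat" where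
  "B_length n w = card (Lambda n w) + card (Sigma_short n w)"

definition D_length :: "nat \<Rightarrow> real mat \<Rightarrow> nat" where
  "D_length n w = card (Lambda n w)"

text \<open>A signed cycle is a list of pairs \<open>(i, s)\<close> with distinct entries \<open>i\<close> in \<open>{1..n}\<close> and signs
  \<open>s\<close> equal to \<open>1\<close> or \<open>-1\<close>. The cyclic successors of the entries are obtained by \<open>rotate1\<close>, so an
  entry \<open>(i, s)\<close> followed by \<open>j\<close> means that \<open>e\<^sub>i\<close> is sent to \<open>s e\<^sub>j\<close>. Basis vectors whose index does
  not occur in the cycle are fixed.\<close>

definition signed_cycle_image :: "nat \<Rightarrow> (nat \<times> real) list \<Rightarrow> nat \<Rightarrow> real vec" where
  "signed_cycle_image n c k =
    (case map_of (zip (map fst c) (zip (map snd c) (rotate1 (map fst c)))) k of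
       None \<Rightarrow> std_basis n k
     | Some (s, j) \<Rightarrow> s \<cdot>\<^sub>v std_basis n j)"

definition signed_cycle :: "nat \<Rightarrow> (nat \<times> real) list \<Rightarrow> real mat" where
  "signed_cycle n c = mat_of_cols n (map (signed_cycle_image n c) [1..<Suc n])"

text \<open>The parts \<open>\<lambda>\<^sub>1, \<dots>, \<lambda>\<^sub>m\<close> are \<open>lam ! 0, \<dots>, lam ! (m - 1)\<close>.\<close>

definition mu :: "nat list \<Rightarrow> nat \<Rightarrow> nat" where
  "mu lam i = (\<Sum>j = 1..<i. lam ! (j - 1))"

definition w_cycle :: "nat \<Rightarrow> nat list \<Rightarrow> nat \<Rightarrow> nat \<Rightarrow> real mat" where
  "w_cycle n lam rho i =
    signed_cycle n
      (map (\<lambda>k. (k, if rho < i \<and> k = mu lam (i + 1) then 1 else - 1))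
        [mu lam i + 1..<mu lam (i + 1) + 1])"

definition w_elt :: "nat \<Rightarrow> nat list \<Rightarrow> nat \<Rightarrow> real mat" where
  "w_elt n lam rho =
    foldr (*) (map (w_cycle n lam rho) [1..<length lam + 1]) (1\<^sub>m n)"

text \<open>Here a partition is a sequence of positive integers that need not be monotone.\<close>

definition is_partition :: "nat \<Rightarrow> nat list \<Rightarrow> bool" where
  "is_partition n lam \<longleftrightarrow> (\<forall>x \<in> set lam. 0 < x) \<and> sum_list lam = n"

definition maximal_split_partition :: "nat \<Rightarrow> nat \<Rightarrow> nat list \<Rightarrow> bool" where
  "maximal_split_partition n rho lam \<longleftrightarrow>
    is_partition n lam \<and> rho \<le> length lam \<and>
    sorted_wrt (\<ge>) (take rho lam) \<and> sorted_wrt (\<ge>) (drop rho lam)"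

end

theory Submission
  imports Defs
begin

text \<open>Multiplication by the central element \<open>-1\<close> complements inversion sets, so the claim is that
  \<open>u = - w\<^sub>\<lambda>\<^sub>,\<^sub>\<rho>\<close> has minimal length in its class. Conjugating \<open>u\<close> amounts to keeping \<open>u\<close> and
  replacing the height function that defines positivity by another one, \<open>G\<close>. The roots are split
  according to the pair of cycles of \<open>u\<close> that their support meets, and every part is treated
  separately. Let \<open>m\<close> be the index of a cycle of length \<open>a\<close> at which \<open>G\<close> is largest. A root \<open>m + q\<close>,
  with \<open>q\<close> in another cycle on which \<open>G\<close> is smaller, is positive; if the cycle of \<open>m\<close> is
  negative, then \<open>u\<^sup>a m = -m\<close>, so the root has become negative after \<open>a\<close> steps and is inverted on
  its way. This gives at least \<open>2 min(a, b)\<close> inversions between two negative cycles of lengths \<open>a\<close>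
  and \<open>b\<close>; the same argument gives \<open>a - 1\<close> inversions within a cycle and one inverted short root in
  a negative cycle. For \<open>u\<close> itself all these bounds are attained because the lengths of the negative
  cycles decrease.\<close>

section \<open>Flips along cycles\<close>

text \<open>Summing over fibres allows the minimality proof to compare flips separately for each
  block or pair of blocks.\<close>

lemma card_le_fibrewise:
  assumes "finite A" "finite B"
    and le: "\<And>i. card {a \<in> A. \<phi> a = i} \<le> card {b \<in> B. \<psi> b = i}"
  shows "card A \<le> card B"
proof -
  let ?I = "\<phi> ` A \<union> \<psi> ` B"
  have "card A = (\<Sum>i\<in>?I. card {a \<in> A. \<phi> a = i})"
    using sum.group[of A ?I \<phi> "\<lambda>_. 1::nat"] assms(1,2) by simp
  also have "\<dots> \<le> (\<Sum>i\<in>?I. card {b \<in> B. \<psi> b = i})"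
    by (intro sum_mono le)
  also have "\<dots> = card B"
    using sum.group[of B ?I \<psi> "\<lambda>_. 1::nat"] assms(1,2) by simp
  finally show ?thesis .
qed

text \<open>A discrete intermediate value theorem. Applied to the values of \<open>G\<close> along
  an orbit, it finds the step at which a root turns from positive to negative.\<close>

lemma sign_change:
  fixes s :: "nat \<Rightarrow> int"
  assumes "0 < s 0" "s N < 0" "\<And>t. t < N \<Longrightarrow> s t \<noteq> 0"
  shows "\<exists>t<N. 0 < s t \<and> s (Suc t) < 0"
  using assms
proof (induction N)
  case (Suc N)
  show ?case
  proof (cases "s N < 0")
    case True
    then show ?thesis using Suc by (meson less_SucI)
  next
    case False
    then show ?thesis using Suc.prems by (metis lessI linorder_neqE)
  qed
qed simp

text \<open>Signed indices stand for the vectors \<open>\<plusminus>e\<^sub>i\<close>, and a pair \<open>(p, q)\<close> for the root that is their sum.\<close>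

definition flips :: "(int \<Rightarrow> int) \<Rightarrow> (int \<Rightarrow> int) \<Rightarrow> int set \<Rightarrow> int set \<Rightarrow> (int \<times> int) set" where
  "flips f G X Y = {(p, q). p \<in> X \<and> q \<in> Y \<and> 0 < G p + G q \<and> G (f p) + G (f q) < 0}"

lemma finite_flips: "finite X \<Longrightarrow> finite Y \<Longrightarrow> finite (flips f G X Y)"
  by (rule finite_subset[of _ "X \<times> Y"]) (auto simp: flips_def)

lemma card_flips_swap: "card (flips f G X Y) = card (flips f G Y X)"
proof -
  have "flips f G Y X = prod.swap ` flips f G X Y"
    by (auto simp: flips_def image_iff add.commute)
  then show ?thesis by (simp add: card_image)
qed

lemma funpow_closed: "f ` X \<subseteq> X \<Longrightarrow> x \<in> X \<Longrightarrow> (f ^^ t) x \<in> X"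
  by (induction t) auto

text \<open>Every root \<open>m + q\<close> with \<open>q \<in> Y\<close> is positive because \<open>m\<close> dominates, and it becomes negative
  after \<open>a\<close> steps because \<open>m\<close> is then replaced by \<open>-m\<close>. So each orbit segment contains a flip.\<close>

lemma card_flips_cross:
  assumes fin: "finite X" "finite Y"
    and cl: "f ` X \<subseteq> X" "f ` Y \<subseteq> Y" and inj: "inj_on f Y"
    and m: "m \<in> X" "(f ^^ a) m = - m" "inj_on (\<lambda>t. (f ^^ t) m) {..<a}" "G (- m) = - G m"
    and dom: "\<And>q. q \<in> Y \<Longrightarrow> \<bar>G q\<bar> < G m"
    and nz: "\<And>p q. p \<in> X \<Longrightarrow> q \<in> Y \<Longrightarrow> G p + G q \<noteq> 0"
  shows "card Y \<le> card (flips f G X Y)"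
proof -
  have "\<exists>t<a. 0 < G ((f ^^ t) m) + G ((f ^^ t) q) \<and>
      G ((f ^^ Suc t) m) + G ((f ^^ Suc t) q) < 0" if q: "q \<in> Y" for q
  proof (rule sign_change[where s = "\<lambda>t. G ((f ^^ t) m) + G ((f ^^ t) q)"])
    show "0 < G ((f ^^ 0) m) + G ((f ^^ 0) q)" using dom[OF q] by simp
    have "\<bar>G ((f ^^ a) q)\<bar> < G m" by (rule dom[OF funpow_closed[OF cl(2) q]])
    then show "G ((f ^^ a) m) + G ((f ^^ a) q) < 0" using m by auto
    show "G ((f ^^ t) m) + G ((f ^^ t) q) \<noteq> 0" for t
      by (intro nz funpow_closed cl q m(1))
  qed
  then obtain T where T: "\<And>q. q \<in> Y \<Longrightarrow> T q < a \<and> 0 < G ((f ^^ T q) m) + G ((f ^^ T q) q) \<and>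
      G ((f ^^ Suc (T q)) m) + G ((f ^^ Suc (T q)) q) < 0" by metis
  have injp: "inj_on (f ^^ t) Y" for t
  proof (induction t)
    case (Suc t)
    moreover have "(f ^^ t) ` Y \<subseteq> Y" using funpow_closed[OF cl(2)] by blast
    ultimately show ?case
      unfolding funpow.simps by (intro comp_inj_on) (auto intro: inj_on_subset[OF inj])
  qed simp
  let ?F = "\<lambda>q. ((f ^^ T q) m, (f ^^ T q) q)"
  \<comment> \<open>The first component is an iterate of \<open>m\<close> with exponent below
    \<open>a\<close>, so it determines \<open>T q\<close>; injectivity of that power of
    \<open>f\<close> on \<open>Y\<close> then recovers \<open>q\<close>.\<close>
  have "inj_on ?F Y"
  proof (rule inj_onI)
    fix q q' assume h: "q \<in> Y" "q' \<in> Y" "?F q = ?F q'"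
    then have "T q = T q'" using inj_onD[OF m(3), of "T q" "T q'"] T by auto
    then show "q = q'" using h injp[of "T q"] by (auto dest: inj_onD)
  qed
  moreover have "?F ` Y \<subseteq> flips f G X Y"
    using T funpow_closed[OF cl(1) m(1)] funpow_closed[OF cl(2)] by (auto simp: flips_def)
  ultimately show ?thesis by (rule card_inj_on_le) (rule finite_flips[OF fin])
qed

text \<open>For \<open>0 < d < a\<close> the root \<open>m - \<kappa> f\<^sup>d m\<close> is positive and becomes negative after \<open>a - d\<close> steps;
  the flips found for different \<open>d\<close> are told apart by the distance \<open>d\<close> along the cycle.\<close>

lemma card_flips_within:
  assumes fin: "finite X" and cl: "f ` X \<subseteq> X" "uminus ` X \<subseteq> X"
    and odd: "\<And>x. x \<in> X \<Longrightarrow> f (- x) = - f x" "\<And>x. x \<in> X \<Longrightarrow> G (- x) = - G x"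
    and m: "m \<in> X" "(f ^^ a) m = \<kappa> * m" "inj_on (\<lambda>t. \<bar>(f ^^ t) m\<bar>) {..<a}"
    and \<kappa>: "\<kappa> = 1 \<or> \<kappa> = -1"
    and dom: "\<And>q. q \<in> X \<Longrightarrow> \<bar>q\<bar> \<noteq> \<bar>m\<bar> \<Longrightarrow> \<bar>G q\<bar> < G m"
    and nz: "\<And>p q. p \<in> X \<Longrightarrow> q \<in> X \<Longrightarrow> \<bar>p\<bar> \<noteq> \<bar>q\<bar> \<Longrightarrow> G p + G q \<noteq> 0"
  shows "a - 1 \<le> card {(p, q) \<in> flips f G X X. \<bar>p\<bar> < \<bar>q\<bar>}"
proof -
  let ?D = "{(p, q) \<in> flips f G X X. \<bar>p\<bar> < \<bar>q\<bar>}"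
  define u where "u t = (f ^^ t) m" for t
  \<comment> \<open>The position of \<open>x\<close>, up to sign, on the cycle of \<open>m\<close>.
    It allows \<open>d\<close> to be read off a flip whatever the signs and the order of its entries
    are.\<close>
  define \<tau> where "\<tau> x = the_inv_into {..<a} (\<lambda>t. \<bar>u t\<bar>) \<bar>x\<bar>" for x
  have uX: "u t \<in> X" for t unfolding u_def by (rule funpow_closed[OF cl(1) m(1)])
  have kX: "- \<kappa> * x \<in> X" if "x \<in> X" for x using \<kappa> cl(2) that by auto
  have fk: "f (- \<kappa> * x) = - \<kappa> * f x" if "x \<in> X" for x
    using \<kappa> odd(1)[OF that] by auto
  have \<tau>u: "\<tau> x = t" if "t < a" "\<bar>x\<bar> = \<bar>u t\<bar>" for t x
    unfolding \<tau>_def using m(3) that by (intro the_inv_into_f_eq) (auto simp: u_def[abs_def])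
  have ne: "\<bar>u s\<bar> \<noteq> \<bar>u t\<bar>" if "s < a" "t < a" "s \<noteq> t" for s t
    using inj_onD[OF m(3), of s t] that by (auto simp: u_def)
  have absk: "\<bar>- \<kappa> * x\<bar> = \<bar>x\<bar>" for x using \<kappa> by auto
  have "{1..<a} \<subseteq> (\<lambda>(p, q). nat \<bar>int (\<tau> p) - int (\<tau> q)\<bar>) ` ?D"
  proof
    fix d assume d: "d \<in> {1..<a}"
    \<comment> \<open>The factor \<open>- \<kappa>\<close> is chosen so that after
      \<open>a - d\<close> steps the second entry is \<open>- \<kappa> * u a = - m\<close>. Thus
      \<open>m\<close> dominates at the start of the sequence and \<open>- m\<close> at its
      end.\<close>
    let ?s = "\<lambda>t. G (u t) + G (- \<kappa> * u (t + d))"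
    have "\<exists>t<a - d. 0 < ?s t \<and> ?s (Suc t) < 0"
    proof (rule sign_change)
      have "\<bar>G (- \<kappa> * u d)\<bar> < G m"
        by (rule dom[OF kX[OF uX]]) (use ne[of d 0] absk d in \<open>simp add: u_def\<close>)
      then show "0 < ?s 0" by (simp add: u_def)
      have "- \<kappa> * u a = - m" using \<kappa> m(2) by (auto simp: u_def)
      moreover have "\<bar>G (u (a - d))\<bar> < G m"
        by (rule dom[OF uX]) (use ne[of "a - d" 0] d in \<open>auto simp: u_def\<close>)
      ultimately show "?s (a - d) < 0" using d odd(2)[OF m(1)] by auto
      show "?s t \<noteq> 0" if "t < a - d" for t
        by (rule nz[OF uX kX[OF uX]]) (use ne[of t "t + d"] absk that d in auto)
    qed
    then obtain t where t: "t < a - d" "0 < ?s t" "?s (Suc t) < 0" by blast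
    let ?p = "u t" and ?q = "- \<kappa> * u (t + d)"
    have fu: "f ?p = u (Suc t)" "f ?q = - \<kappa> * u (Suc t + d)"
      using fk[OF uX] by (auto simp: u_def)
    have tau: "\<tau> ?p = t" "\<tau> ?q = t + d" using \<tau>u[of t] \<tau>u[of "t + d"] t(1) absk by auto
    \<comment> \<open>Both orders of the pair are flips, so the one with increasing absolute values,
      as \<open>?D\<close> demands, is available.\<close>
    have pq: "(?p, ?q) \<in> flips f G X X" "(?q, ?p) \<in> flips f G X X"
      using t fu uX kX[OF uX] by (auto simp: flips_def add.commute)
    have "\<bar>?p\<bar> \<noteq> \<bar>?q\<bar>" using ne[of t "t + d"] absk t(1) d by auto
    then consider "\<bar>?p\<bar> < \<bar>?q\<bar>" | "\<bar>?q\<bar> < \<bar>?p\<bar>" by linarith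
    then show "d \<in> (\<lambda>(p, q). nat \<bar>int (\<tau> p) - int (\<tau> q)\<bar>) ` ?D"
    proof cases
      case 1
      then show ?thesis using pq tau by (intro image_eqI[of _ _ "(?p, ?q)"]) auto
    next
      case 2
      then show ?thesis using pq tau by (intro image_eqI[of _ _ "(?q, ?p)"]) auto
    qed
  qed
  moreover have "finite ?D" by (rule finite_subset[OF _ finite_flips[OF fin fin, of f G]]) auto
  ultimately have "card {1..<a} \<le> card ?D" by (rule surj_card_le[rotated])
  then show ?thesis by simp
qed

section \<open>The normal form on signed indices\<close>

definition signed_ints :: "nat \<Rightarrow> int set" where
  "signed_ints n = {x. x \<noteq> 0 \<and> \<bar>x\<bar> \<le> int n}"

lemma finite_signed_ints: "finite (signed_ints n)"
  by (rule finite_subset[of _ "{- int n..int n}"]) (auto simp: signed_ints_def)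

text \<open>The height reverses the order of absolute values, so that a long root, written as a sum of two
  signed basis vectors, is positive iff the sum of the heights is positive.\<close>

definition height :: "nat \<Rightarrow> int \<Rightarrow> int" where
  "height n x = sgn x * (int n + 1 - \<bar>x\<bar>)"

text \<open>Blocks are numbered from \<open>0\<close>: block \<open>k\<close> is the support of \<open>w\<^sub>k\<^sub>+\<^sub>1\<close>, and \<open>start lam k\<close> is \<open>\<mu>\<^sub>k\<^sub>+\<^sub>1\<close>.\<close>

definition start :: "nat list \<Rightarrow> nat \<Rightarrow> nat" where
  "start lam k = sum_list (take k lam)"

definition block :: "nat list \<Rightarrow> nat \<Rightarrow> nat" where
  "block lam j = (LEAST k. j \<le> start lam (Suc k))"

text \<open>Negation turns an all-minus cycle into one with plus signs only, and each other cycle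
  into one whose single minus sign sits at its last entry. The power of such a cycle by its length
  is the scalar given here.\<close>

definition cycle_sign :: "nat \<Rightarrow> nat \<Rightarrow> int" where
  "cycle_sign rho k = (if k < rho then 1 else - 1)"

text \<open>The action of \<open>- w\<^sub>\<lambda>\<^sub>,\<^sub>\<rho>\<close> on signed indices.\<close>

definition cyc :: "nat list \<Rightarrow> nat \<Rightarrow> int \<Rightarrow> int" where
  "cyc lam rho p = (let k = block lam (nat \<bar>p\<bar>) in
     sgn p * (if \<bar>p\<bar> < int (start lam (Suc k)) then \<bar>p\<bar> + 1
       else cycle_sign rho k * (int (start lam k) + 1)))"

definition block_set :: "nat list \<Rightarrow> nat \<Rightarrow> int set" where
  "block_set lam k = {p. int (start lam k) < \<bar>p\<bar> \<and> \<bar>p\<bar> \<le> int (start lam (Suc k))}"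

lemma cycle_sign_cases: "cycle_sign rho k = 1 \<or> cycle_sign rho k = -1"
  by (simp add: cycle_sign_def)

lemma start_Suc: "k < length lam \<Longrightarrow> start lam (Suc k) = start lam k + lam ! k"
  by (simp add: start_def take_Suc_conv_app_nth)

lemma start_mono: "i \<le> j \<Longrightarrow> start lam i \<le> start lam j"
proof (rule lift_Suc_mono_le[of "start lam"])
  show "start lam k \<le> start lam (Suc k)" for k
    by (cases "k < length lam") (simp_all add: start_Suc, simp add: start_def)
qed

lemma block_eq: "start lam k < j \<Longrightarrow> j \<le> start lam (Suc k) \<Longrightarrow> block lam j = k"
  unfolding block_def
proof (rule Least_equality)
  fix y assume "start lam k < j" "j \<le> start lam (Suc y)"
  then show "k \<le> y" using start_mono[of "Suc y" k lam] by (meson le_trans not_less not_less_eq_eq)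
qed

lemma block_bounds:
  assumes "0 < j" "j \<le> sum_list lam"
  shows "block lam j < length lam" "start lam (block lam j) < j" "j \<le> start lam (Suc (block lam j))"
proof -
  have all: "start lam k = sum_list lam" if "length lam \<le> k" for k
    using that by (simp add: start_def)
  show 1: "j \<le> start lam (Suc (block lam j))"
    unfolding block_def by (rule LeastI[where k = "length lam"]) (simp add: all assms)
  show 2: "start lam (block lam j) < j"
  proof (cases "block lam j")
    case 0
    then show ?thesis using assms by (simp add: start_def)
  next
    case (Suc k)
    then show ?thesis using not_less_Least[of k "\<lambda>k. j \<le> start lam (Suc k)"]
      by (simp add: block_def[symmetric])
  qed
  show "block lam j < length lam" using 2 all[of "block lam j"] assms by linarith
qed

lemma block_set_sym: "p \<in> block_set lam k \<Longrightarrow> - p \<in> block_set lam k"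
  by (simp add: block_set_def)

lemma block_of_block_set: "p \<in> block_set lam k \<Longrightarrow> block lam (nat \<bar>p\<bar>) = k"
  by (rule block_eq) (auto simp: block_set_def)

lemma card_block_set: "k < length lam \<Longrightarrow> card (block_set lam k) = 2 * lam ! k"
proof -
  assume k: "k < length lam"
  let ?A = "{int (start lam k) + 1..int (start lam (Suc k))}"
  have "block_set lam k = ?A \<union> uminus ` ?A"
  proof (intro equalityI subsetI)
    fix p assume "p \<in> block_set lam k"
    then show "p \<in> ?A \<union> uminus ` ?A"
      by (cases "p \<ge> 0") (auto simp: block_set_def intro!: image_eqI[of p uminus "- p"])
  qed (auto simp: block_set_def)
  moreover have "?A \<inter> uminus ` ?A = {}" by auto
  ultimately show ?thesis using k by (simp add: card_Un_disjoint card_image start_Suc)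
qed

lemma finite_block_set: "finite (block_set lam k)"
  by (rule finite_subset[of _ "{- int (start lam (Suc k))..int (start lam (Suc k))}"])
    (auto simp: block_set_def)

lemma cyc_odd: "cyc lam rho (- p) = - cyc lam rho p"
  by (simp add: cyc_def Let_def)

lemma cyc_eq:
  "p \<in> block_set lam k \<Longrightarrow> cyc lam rho p = sgn p * (if \<bar>p\<bar> < int (start lam (Suc k)) then \<bar>p\<bar> + 1
     else cycle_sign rho k * (int (start lam k) + 1))"
  by (simp add: cyc_def block_of_block_set)

lemma cyc_block_set:
  "p \<in> block_set lam k \<Longrightarrow> cyc lam rho p \<in> block_set lam k"
  using cycle_sign_cases[of rho k] by (auto simp: cyc_eq block_set_def abs_mult)

text \<open>In at most \<open>lam ! k\<close> steps the end of the block is passed at most once, so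
  the cycle sign enters at most once.\<close>

lemma cyc_funpow:
  assumes k: "k < length lam" and p: "p \<in> block_set lam k" and "t \<le> lam ! k"
  shows "(cyc lam rho ^^ t) p = sgn p * (if \<bar>p\<bar> + int t \<le> int (start lam (Suc k)) then \<bar>p\<bar> + int t
     else cycle_sign rho k * (\<bar>p\<bar> + int t - int (lam ! k)))"
  using assms(3)
proof (induction t)
  case 0
  then show ?case using p by (simp add: block_set_def sgn_mult_abs)
next
  case (Suc t)
  have b: "(cyc lam rho ^^ t) p \<in> block_set lam k"
    by (rule funpow_closed[OF _ p]) (use cyc_block_set in blast)
  show ?case
    unfolding funpow.simps comp_apply cyc_eq[OF b] using Suc p start_Suc[OF k] cycle_sign_cases[of rho k]
    by (auto simp: block_set_def abs_mult sgn_mult)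
qed

lemma cyc_period:
  assumes "k < length lam" and p: "p \<in> block_set lam k"
  shows "(cyc lam rho ^^ (lam ! k)) p = cycle_sign rho k * p"
  using cyc_funpow[OF assms order.refl] p start_Suc[OF assms(1)]
  by (auto simp: block_set_def algebra_simps mult_sgn_abs abs_mult_sgn)

lemma inj_on_abs_cyc:
  assumes k: "k < length lam" and p: "p \<in> block_set lam k"
  shows "inj_on (\<lambda>t. \<bar>(cyc lam rho ^^ t) p\<bar>) {..<lam ! k}"
proof (rule inj_onI)
  fix s t assume h: "s \<in> {..<lam ! k}" "t \<in> {..<lam ! k}"
    "\<bar>(cyc lam rho ^^ s) p\<bar> = \<bar>(cyc lam rho ^^ t) p\<bar>"
  have "p \<noteq> 0" using p by (auto simp: block_set_def)
  with h show "s = t"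
    using cyc_funpow[OF k p, of s] cyc_funpow[OF k p, of t] p start_Suc[OF k] cycle_sign_cases[of rho k]
    by (auto simp: block_set_def abs_mult split: if_splits)
qed

text \<open>The power of \<open>cyc\<close> with the positive exponent \<open>lam ! k\<close> is
  multiplication by 1 or -1 on the block, so \<open>cyc\<close> itself cannot identify two
  points.\<close>

lemma inj_on_cyc:
  assumes "k < length lam" "0 < lam ! k"
  shows "inj_on (cyc lam rho) (block_set lam k)"
proof (rule inj_onI)
  fix p q assume h: "p \<in> block_set lam k" "q \<in> block_set lam k" "cyc lam rho p = cyc lam rho q"
  have "(cyc lam rho ^^ (lam ! k)) p = (cyc lam rho ^^ (lam ! k)) q"
    using assms(2) h(3) by (cases "lam ! k") (simp_all add: funpow_swap1)
  then show "p = q" using cyc_period[OF assms(1)] h cycle_sign_cases[of rho k] by auto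
qed

lemma block_set_subset: "block_set lam k \<subseteq> signed_ints (sum_list lam)"
proof -
  have "start lam (Suc k) \<le> sum_list lam"
    using start_mono[of "Suc k" "max (Suc k) (length lam)" lam] by (simp add: start_def)
  then show ?thesis by (auto simp: block_set_def signed_ints_def)
qed

lemma signed_ints_block:
  assumes "p \<in> signed_ints (sum_list lam)"
  shows "block lam (nat \<bar>p\<bar>) < length lam" "p \<in> block_set lam (block lam (nat \<bar>p\<bar>))"
proof -
  have "0 < nat \<bar>p\<bar>" "nat \<bar>p\<bar> \<le> sum_list lam" using assms by (auto simp: signed_ints_def)
  from block_bounds[OF this] show "block lam (nat \<bar>p\<bar>) < length lam"
    "p \<in> block_set lam (block lam (nat \<bar>p\<bar>))"
    by (simp_all add: block_set_def zless_nat_eq_int_zless nat_le_iff)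
qed

section \<open>Minimal flip counts of the normal form\<close>

lemma ex_dominant:
  fixes G :: "int \<Rightarrow> int"
  assumes "finite X" "X \<noteq> {}" and sym: "\<And>x. x \<in> X \<Longrightarrow> - x \<in> X"
    and odd: "\<And>x. x \<in> X \<Longrightarrow> G (- x) = - G x" and nz: "\<And>x. x \<in> X \<Longrightarrow> G x \<noteq> 0"
  shows "\<exists>m\<in>X. 0 < G m \<and> (\<forall>q\<in>X. \<bar>G q\<bar> \<le> G m)"
proof -
  let ?M = "Max ((\<lambda>x. \<bar>G x\<bar>) ` X)"
  have "?M \<in> (\<lambda>x. \<bar>G x\<bar>) ` X" using assms(1,2) by (intro Max_in) auto
  then obtain m where m: "m \<in> X" "\<bar>G m\<bar> = ?M" by auto
  have le: "\<bar>G q\<bar> \<le> \<bar>G m\<bar>" if "q \<in> X" for q using m that assms(1) by auto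
  show ?thesis
  proof (cases "0 < G m")
    case True
    then show ?thesis using m le by force
  next
    case False
    then have "0 < G (- m)" "\<bar>G m\<bar> = G (- m)" using nz[OF m(1)] odd[OF m(1)] by auto
    then show ?thesis using m le sym by metis
  qed
qed

text \<open>For the height \<open>h\<close> the possible flips can be listed explicitly, and in each
  block or pair of blocks there are no more of them than the lower bound for a general
  \<open>G\<close>. In the application \<open>G\<close> is the height composed with the signed
  permutation of a conjugating element.\<close>

lemma cyc_flips_minimal:
  fixes G :: "int \<Rightarrow> int"
  assumes pos: "\<forall>x\<in>set lam. 0 < x" and n: "sum_list lam = n"
    and sorted: "sorted_wrt (\<ge>) (drop rho lam)"
    and odd: "\<And>x. x \<in> signed_ints n \<Longrightarrow> G (- x) = - G x"
    and nz: "\<And>x. x \<in> signed_ints n \<Longrightarrow> G x \<noteq> 0"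
    and inj: "\<And>x y. x \<in> signed_ints n \<Longrightarrow> y \<in> signed_ints n \<Longrightarrow> \<bar>G x\<bar> = \<bar>G y\<bar> \<Longrightarrow> \<bar>x\<bar> = \<bar>y\<bar>"
  defines "f \<equiv> cyc lam rho" and "I \<equiv> signed_ints n" and "h \<equiv> height n"
  shows "card {(p, q) \<in> flips f h I I. \<bar>p\<bar> < \<bar>q\<bar>} \<le> card {(p, q) \<in> flips f G I I. \<bar>p\<bar> < \<bar>q\<bar>}" (is "card ?Dh \<le> card ?DG")
    and "card {p \<in> I. 0 < h p \<and> h (f p) < 0} \<le> card {p \<in> I. 0 < G p \<and> G (f p) < 0}" (is "card ?Sh \<le> card ?SG")
proof -
  let ?B = "block_set lam" and ?m = "length lam" and ?blk = "\<lambda>p::int. block lam (nat \<bar>p\<bar>)"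
  let ?a = "\<lambda>k. lam ! k" and ?b = "\<lambda>k. int (start lam (Suc k))" and ?\<kappa> = "cycle_sign rho"
  have fin: "finite I" unfolding I_def by (rule finite_signed_ints)
  have BI: "?B k \<subseteq> I" for k
    using block_set_subset[of lam k] n by (simp add: I_def)
  have inB: "?blk p < ?m \<and> p \<in> ?B (?blk p)" if "p \<in> I" for p
    using signed_ints_block[of p lam] that n by (simp add: I_def)
  have blkB: "p \<in> ?B k \<longleftrightarrow> ?blk p = k" if "p \<in> I" for p k
    using inB[OF that] block_of_block_set by blast
  have apos: "0 < ?a k" if "k < ?m" for k using pos that by simp
  have Bne: "?B k \<noteq> {}" if "k < ?m" for k
    using card_block_set[OF that] apos[OF that] by (metis card.empty mult_eq_0_iff not_less_iff_gr_or_eq numeral_eq_iff zero_neq_numeral)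
  have fB: "f p \<in> ?B k" if "p \<in> ?B k" for p k using cyc_block_set that unfolding f_def by blast
  have fBi: "f ` ?B k \<subseteq> ?B k" for k using fB by blast
  have hsgn: "0 < h p \<longleftrightarrow> 0 < p" "h p < 0 \<longleftrightarrow> p < 0" if "p \<in> I" for p
    using that by (auto simp: h_def height_def I_def signed_ints_def sgn_if)
  \<comment> \<open>The entry of smaller absolute value has the height of larger absolute value, so
    its sign decides the sign of the sum.\<close>
  have hdom: "0 < h p + h q \<longleftrightarrow> 0 < p" "h p + h q < 0 \<longleftrightarrow> p < 0"
    "0 < h q + h p \<longleftrightarrow> 0 < p" "h q + h p < 0 \<longleftrightarrow> p < 0" if "p \<in> I" "q \<in> I" "\<bar>p\<bar> < \<bar>q\<bar>" for p q
    using that by (auto simp: h_def height_def I_def signed_ints_def sgn_if split: if_splits)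
  \<comment> \<open>This supplies the point \<open>m\<close> for \<open>card_flips_within\<close>
    and \<open>card_flips_cross\<close>: a maximiser of the absolute value of \<open>G\<close> on
    the block, negated if necessary.\<close>
  have dominant: "\<exists>m\<in>?B k. 0 < G m \<and> (\<forall>q\<in>?B k. \<bar>G q\<bar> \<le> G m)" if "k < ?m" for k
    using BI[of k] odd nz
    by (intro ex_dominant finite_block_set Bne[OF that] block_set_sym) (auto simp: I_def)
  have sum_nz: "G p + G q \<noteq> 0" if "p \<in> I" "q \<in> I" "\<bar>p\<bar> \<noteq> \<bar>q\<bar>" for p q
  proof
    assume "G p + G q = 0"
    then have "\<bar>G p\<bar> = \<bar>G q\<bar>" by linarith
    then show False using inj[of p q] that by (simp add: I_def)
  qed
  have block_le: "k \<le> l" if "p \<in> ?B k" "q \<in> ?B l" "\<bar>p\<bar> < \<bar>q\<bar>" for p q k l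
  proof (rule ccontr)
    assume "\<not> k \<le> l"
    then have "start lam (Suc l) \<le> start lam k" by (intro start_mono) simp
    then show False using that by (simp add: block_set_def)
  qed
  have block_less: "\<bar>p\<bar> < \<bar>q\<bar>" if "p \<in> ?B k" "q \<in> ?B l" "k < l" for p q k l
    using that start_mono[of "Suc k" l lam] by (simp add: block_set_def)

  \<comment> \<open>The candidates for flips of \<open>h\<close>: signs change only when the end of
    a block is passed. Inside a block it is \<open>q\<close> that passes the end, lands on minus the
    first entry and becomes decisive. Between blocks the entry in the earlier block stays decisive,
    so \<open>p\<close> itself must pass the end of a negative cycle.\<close>
  have up: "0 < p \<and> (k = l \<and> \<bar>p\<bar> < ?b k \<and> q = - ?\<kappa> k * ?b k \<or> k < l \<and> rho \<le> k \<and> p = ?b k)"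
    if "p \<in> ?B k" "q \<in> ?B l" "(p, q) \<in> ?Dh" for p q k l
  proof -
    have I: "p \<in> I" "q \<in> I" "f p \<in> I" "f q \<in> I" using that BI fB by blast+
    have pq: "\<bar>p\<bar> < \<bar>q\<bar>" "0 < h p + h q" "h (f p) + h (f q) < 0" using that by (auto simp: flips_def)
    have p0: "0 < p" using hdom[OF I(1,2)] pq by simp
    have kl: "k \<le> l" by (rule block_le[OF that(1,2) pq(1)])
    show ?thesis
    proof (cases "k = l")
      case True
      have pb: "\<bar>p\<bar> < ?b k" using pq that True by (simp add: block_set_def)
      then have fp: "f p = p + 1" using p0 by (simp add: f_def cyc_eq[OF that(1)])
      \<comment> \<open>Otherwise both absolute values grow by one, \<open>f p = p + 1\<close> stays
        decisive, and the root remains positive.\<close>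
      have "\<bar>q\<bar> = ?b k"
      proof (rule ccontr)
        assume "\<bar>q\<bar> \<noteq> ?b k"
        then have "\<bar>q\<bar> < ?b l" using that True by (simp add: block_set_def)
        then have "\<bar>f q\<bar> = \<bar>q\<bar> + 1" using I(2)
          by (auto simp: f_def cyc_eq[OF that(2)] abs_mult I_def signed_ints_def)
        then show False using hdom[OF I(3,4)] fp pq p0 by auto
      qed
      then have fq: "f q = sgn q * ?\<kappa> k * (int (start lam k) + 1)"
        using True by (simp add: f_def cyc_eq[OF that(2)])
      have "int (start lam k) < p" using that(1) p0 by (simp add: block_set_def)
      moreover have "\<bar>f q\<bar> = int (start lam k) + 1"
        using I(2) cycle_sign_cases[of rho k] by (auto simp: fq abs_mult I_def signed_ints_def)
      ultimately have "f q < 0" using hdom[OF I(4,3)] fp p0 pq by auto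
      then have "sgn q * ?\<kappa> k < 0" unfolding fq by (simp add: mult_less_0_iff)
      then have "q = - ?\<kappa> k * ?b k" using cycle_sign_cases[of rho k] \<open>\<bar>q\<bar> = ?b k\<close>
        by (auto simp: sgn_if split: if_splits)
      then show ?thesis using p0 True pb by simp
    next
      case False
      then have "\<bar>f p\<bar> < \<bar>f q\<bar>" using kl that fB by (intro block_less[of _ k _ l]) auto
      then have "f p < 0" using hdom[OF I(3,4)] pq by simp
      then have "\<bar>p\<bar> = ?b k \<and> ?\<kappa> k < 0" using p0 that(1)
        by (auto simp: f_def cyc_eq[OF that(1)] block_set_def mult_less_0_iff split: if_splits)
      then show ?thesis using p0 kl False by (auto simp: cycle_sign_def split: if_splits)
    qed
  qed

  show "card ?Dh \<le> card ?DG"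
  proof (rule card_le_fibrewise[where \<phi> = "\<lambda>(p, q). (?blk p, ?blk q)" and \<psi> = "\<lambda>(p, q). (?blk p, ?blk q)"])
    fix i :: "nat \<times> nat"
    obtain k l where i: "i = (k, l)" by force
    let ?fh = "{a \<in> ?Dh. (case a of (p, q) \<Rightarrow> (?blk p, ?blk q)) = i}"
    let ?fG = "{a \<in> ?DG. (case a of (p, q) \<Rightarrow> (?blk p, ?blk q)) = i}"
    have fib: "p \<in> ?B k \<and> q \<in> ?B l \<and> k < ?m \<and> l < ?m \<and> (p, q) \<in> ?Dh" if "(p, q) \<in> ?fh" for p q
      using that inB[of p] inB[of q] by (auto simp: i flips_def)
    have finG: "finite ?fG"
      by (rule finite_subset[OF _ finite_flips[OF fin fin, of f G]]) auto
    show "card ?fh \<le> card ?fG"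
    proof (cases "?fh = {}")
      case True
      then show ?thesis by (metis card.empty le0)
    next
      case False
      \<comment> \<open>A single flip of \<open>h\<close> in the fibre already forces one of the two
        block configurations of \<open>up\<close>.\<close>
      then obtain p0 q0 where "(p0, q0) \<in> ?fh" by auto
      from fib[OF this] up have km: "k < ?m" "l < ?m" and "k = l \<or> k < l \<and> rho \<le> k" by blast+
      then consider "k = l" | "k < l" "rho \<le> k" by blast
      then show ?thesis
      proof cases
        case 1
        let ?A = "{int (start lam k) + 1..<?b k}"
        \<comment> \<open>By \<open>up\<close>, \<open>q\<close> is fixed and \<open>p\<close> is
          positive but not the last entry of the block, which leaves at most \<open>?a k - 1\<close>
          flips.\<close>
        have "?fh \<subseteq> (\<lambda>p. (p, - ?\<kappa> k * ?b k)) ` ?A"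
        proof
          fix x assume x: "x \<in> ?fh"
          obtain p q where "x = (p, q)" by force
          then show "x \<in> (\<lambda>p. (p, - ?\<kappa> k * ?b k)) ` ?A"
            using fib[of p q] up[of p k q l] x 1 by (auto simp: block_set_def)
        qed
        then have "card ?fh \<le> card ?A" by (rule surj_card_le[rotated]) simp
        also have "\<dots> = ?a k - 1" using start_Suc[OF km(1)] by simp
        also have "\<dots> \<le> card {(p, q) \<in> flips f G (?B k) (?B k). \<bar>p\<bar> < \<bar>q\<bar>}"
        proof -
          obtain m where m: "m \<in> ?B k" "0 < G m" "\<And>q. q \<in> ?B k \<Longrightarrow> \<bar>G q\<bar> \<le> G m"
            using dominant[OF km(1)] by blast
          show ?thesis
          proof (rule card_flips_within[where m = m and \<kappa> = "?\<kappa> k"])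
            show "\<bar>G q\<bar> < G m" if "q \<in> ?B k" "\<bar>q\<bar> \<noteq> \<bar>m\<bar>" for q
              using m inj[of q m] that BI[of k] by (fastforce simp: I_def)
            show "G (- x) = - G x" if "x \<in> ?B k" for x using odd that BI[of k] by (auto simp: I_def)
            show "G p + G q \<noteq> 0" if "p \<in> ?B k" "q \<in> ?B k" "\<bar>p\<bar> \<noteq> \<bar>q\<bar>" for p q
              using sum_nz that BI[of k] by blast
          qed (use m km fBi cyc_odd cyc_period inj_on_abs_cyc finite_block_set block_set_sym
              cycle_sign_cases in \<open>auto simp: f_def\<close>)
        qed
        also have "\<dots> \<le> card ?fG"
          by (rule card_mono[OF finG]) (use BI[of k] blkB 1 in \<open>auto simp: i flips_def\<close>)
        finally show ?thesis .
      next
        case 2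
        \<comment> \<open>Here \<open>p\<close> is the last entry of block \<open>k\<close>, so only
          \<open>q\<close> is free, within the \<open>2 * lam ! l\<close> elements of block
          \<open>l\<close>.\<close>
        have "?fh \<subseteq> (\<lambda>q. (?b k, q)) ` ?B l"
        proof
          fix x assume x: "x \<in> ?fh"
          obtain p q where "x = (p, q)" by force
          then show "x \<in> (\<lambda>q. (?b k, q)) ` ?B l"
            using fib[of p q] up[of p k q l] x 2 by auto
        qed
        then have "card ?fh \<le> card (?B l)" by (rule surj_card_le[OF finite_block_set])
        also have "\<dots> \<le> card (flips f G (?B k) (?B l))"
        proof -
          have \<kappa>: "?\<kappa> k = -1" "?\<kappa> l = -1" using 2 by (auto simp: cycle_sign_def)
          \<comment> \<open>Both blocks lie beyond \<open>rho\<close>; shifting their indices by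
            \<open>rho\<close> makes the ordering of \<open>drop rho lam\<close> applicable.\<close>
          have "?a l \<le> ?a k"
            using sorted_wrt_nth_less[OF sorted, of "k - rho" "l - rho"] 2 km by auto
          then have card_le: "card (?B l) \<le> card (?B k)" using km by (simp add: card_block_set)
          obtain m where m: "m \<in> ?B k" "0 < G m" "\<And>q. q \<in> ?B k \<Longrightarrow> \<bar>G q\<bar> \<le> G m"
            using dominant[OF km(1)] by blast
          obtain m' where m': "m' \<in> ?B l" "0 < G m'" "\<And>q. q \<in> ?B l \<Longrightarrow> \<bar>G q\<bar> \<le> G m'"
            using dominant[OF km(2)] by blast
          \<comment> \<open>Stated for arbitrary blocks because either of the two may contain the
            larger maximum of \<open>G\<close>. If block \<open>l\<close> does, the bound obtained
            is \<open>card (?B k)\<close>, which is at least \<open>card (?B l)\<close>, and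
            swapping the pairs gives the claim.\<close>
          have neg: "card (?B y) \<le> card (flips f G (?B x) (?B y))"
            if x: "x < ?m" "y < ?m" "x \<noteq> y" "?\<kappa> x = -1" and m: "m \<in> ?B x"
              and dom: "\<And>q. q \<in> ?B y \<Longrightarrow> \<bar>G q\<bar> < G m" for x y m
          proof (rule card_flips_cross[where m = m])
            show "(f ^^ ?a x) m = - m" using cyc_period[OF x(1) m, of rho] x(4) by (simp add: f_def)
            show "inj_on (\<lambda>t. (f ^^ t) m) {..<?a x}"
              using inj_on_abs_cyc[OF x(1) m, of rho] unfolding f_def inj_on_def by metis
            show "G (- m) = - G m" using odd m BI[of x] by (auto simp: I_def)
            show "inj_on f (?B y)" unfolding f_def by (rule inj_on_cyc[OF x(2) apos[OF x(2)]])
            show "G p + G q \<noteq> 0" if "p \<in> ?B x" "q \<in> ?B y" for p q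
              using sum_nz[of p q] that BI x(3) block_less[of p x q y] block_less[of q y p x] by fastforce
          qed (use finite_block_set fBi m dom in auto)
          have "\<bar>m\<bar> \<noteq> \<bar>m'\<bar>" using block_less[OF m(1) m'(1) 2(1)] by simp
          then have "G m \<noteq> G m'" using inj[of m m'] m m' BI by (force simp: I_def)
          then consider "G m' < G m" | "G m < G m'" by linarith
          then show ?thesis
          proof cases
            case 1
            show ?thesis by (rule neg[OF km _ _ m(1)]) (use 2 \<kappa> 1 m'(3) in force)+
          next
            case 2
            have "card (?B k) \<le> card (flips f G (?B l) (?B k))"
              by (rule neg[OF km(2,1) _ _ m'(1)]) (use \<open>k < l\<close> \<kappa> 2 m(3) in force)+
            then show ?thesis using card_le card_flips_swap[of f G "?B l" "?B k"] by simp
          qed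
        qed
        also have "\<dots> \<le> card ?fG"
          by (rule card_mono[OF finG])
            (use BI[of k] BI[of l] blkB 2 block_less[of _ k _ l] in \<open>auto simp: i flips_def\<close>)
        finally show ?thesis .
      qed
    qed
  qed (rule finite_subset[OF _ finite_flips[OF fin fin]], blast)+

  show "card ?Sh \<le> card ?SG"
  proof (rule card_le_fibrewise[where \<phi> = ?blk and \<psi> = ?blk])
    fix k
    let ?fh = "{p \<in> ?Sh. ?blk p = k}" and ?fG = "{p \<in> ?SG. ?blk p = k}"
    \<comment> \<open>A positive index becomes negative under \<open>f\<close> only at the last
      entry of a negative cycle, so each block contributes at most one short root.\<close>
    have fib: "p = ?b k \<and> ?\<kappa> k = -1 \<and> k < ?m" if "p \<in> ?fh" for p
    proof -
      have p: "p \<in> ?B k" "k < ?m" using that inB by auto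
      have "0 < p" "f p < 0" using that hsgn fB[OF p(1)] BI by blast+
      then show ?thesis using p cycle_sign_cases[of rho k]
        by (auto simp: f_def cyc_eq[OF p(1)] block_set_def split: if_splits)
    qed
    show "card ?fh \<le> card ?fG"
    proof (cases "?fh = {}")
      case True
      then show ?thesis by (metis card.empty le0)
    next
      case False
      then have k: "k < ?m" "?\<kappa> k = -1" and "?fh \<subseteq> {?b k}" using fib by blast+
      then have "card ?fh \<le> 1" using card_mono[of "{?b k}" ?fh] by simp
      have "?fG \<noteq> {}"
      proof -
        obtain m where m: "m \<in> ?B k" "0 < G m" using dominant[OF k(1)] by blast
        have B: "(f ^^ t) m \<in> ?B k" for t by (rule funpow_closed[OF fBi m(1)])
        \<comment> \<open>Along the negative cycle \<open>G\<close> runs from \<open>G m\<close> to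
          \<open>G (- m) = - G m\<close>, hence changes sign.\<close>
        have "\<exists>t<?a k. 0 < G ((f ^^ t) m) \<and> G ((f ^^ Suc t) m) < 0"
        proof (rule sign_change)
          have "(f ^^ ?a k) m = - m" using cyc_period[OF k(1) m(1), of rho] k(2) by (simp add: f_def)
          then show "G ((f ^^ ?a k) m) < 0" using m odd[of m] BI[of k] by (auto simp: I_def)
          show "G ((f ^^ t) m) \<noteq> 0" for t using nz B BI[of k] by (auto simp: I_def)
        qed (use m in simp)
        then obtain t where "0 < G ((f ^^ t) m)" "G ((f ^^ Suc t) m) < 0" by blast
        then have "(f ^^ t) m \<in> ?fG" using B[of t] BI[of k] blkB by auto
        then show ?thesis by blast
      qed
      moreover have "finite ?fG" using fin by simp
      ultimately have "0 < card ?fG" by (simp only: card_gt_0_iff simp_thms)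
      with \<open>card ?fh \<le> 1\<close> show ?thesis by linarith
    qed
  qed (use fin in simp_all)
qed

section \<open>Signed permutation matrices and roots\<close>

definition signed_vec :: "nat \<Rightarrow> int \<Rightarrow> real vec" where
  "signed_vec n x = (if 0 < x then std_basis n (nat x) else - std_basis n (nat (- x)))"

text \<open>These are the signed permutations in their guise as permutations of -n, ..., -1, 1, ...,
  n commuting with negation. Oddness is what linearity of the matrix becomes on indices.\<close>

definition odd_bij :: "nat \<Rightarrow> (int \<Rightarrow> int) \<Rightarrow> bool" where
  "odd_bij n a \<longleftrightarrow> bij_betw a (signed_ints n) (signed_ints n) \<and> (\<forall>x\<in>signed_ints n. a (- x) = - a x)"

lemma signed_ints_uminus: "x \<in> signed_ints n \<Longrightarrow> - x \<in> signed_ints n"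
  by (simp add: signed_ints_def)

lemma odd_bijD:
  assumes "odd_bij n a" "x \<in> signed_ints n"
  shows "a x \<in> signed_ints n" "a (- x) = - a x"
  using assms by (auto simp: odd_bij_def bij_betw_def)

lemma odd_bij_abs_inj:
  assumes "odd_bij n a" "x \<in> signed_ints n" "y \<in> signed_ints n" "\<bar>a x\<bar> = \<bar>a y\<bar>"
  shows "\<bar>x\<bar> = \<bar>y\<bar>"
proof -
  have inj: "inj_on a (signed_ints n)" using assms(1) by (simp add: odd_bij_def bij_betw_def)
  have "a x = a y \<or> a x = a (- y)" using assms odd_bijD(2)[OF assms(1,3)] by auto
  then show ?thesis using inj_onD[OF inj] assms(2,3) signed_ints_uminus by fastforce
qed

lemma signed_vec_carrier [simp]: "signed_vec n x \<in> carrier_vec n"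
  by (simp add: signed_vec_def std_basis_def)

lemma dim_signed_vec [simp]: "dim_vec (signed_vec n x) = n"
  using signed_vec_carrier carrier_vecD by blast

lemma signed_vec_uminus: "x \<in> signed_ints n \<Longrightarrow> signed_vec n (- x) = - signed_vec n x"
  by (auto simp: signed_vec_def signed_ints_def)

lemma signed_vec_index:
  assumes "x \<in> signed_ints n" "y \<in> signed_ints n"
  shows "signed_vec n y $ (nat \<bar>x\<bar> - 1) = (if \<bar>y\<bar> = \<bar>x\<bar> then of_int (sgn y) else 0)"
proof -
  obtain i where i: "nat \<bar>x\<bar> - 1 = i" "i < n" "\<bar>x\<bar> = int i + 1"
    using assms(1) by (intro that[of "nat \<bar>x\<bar> - 1"]) (auto simp: signed_ints_def)
  obtain j where j: "nat \<bar>y\<bar> - 1 = j" "j < n" "\<bar>y\<bar> = int j + 1"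
    using assms(2) by (intro that[of "nat \<bar>y\<bar> - 1"]) (auto simp: signed_ints_def)
  have "signed_vec n y = (if 0 < y then unit_vec n j else - unit_vec n j)" "y \<noteq> 0"
    using assms(2) j(1) by (auto simp: signed_vec_def std_basis_def signed_ints_def)
  then show ?thesis unfolding i(1) using i(2,3) j(2,3) by (auto simp: sgn_if)
qed

text \<open>Comparing the coordinates at the absolute value of \<open>x\<close> shows that
  \<open>x\<close> occurs on the other side. Hence a long root determines its two signed indices up
  to order, and roots can be counted by pairs.\<close>

lemma signed_vec_sum_inj:
  assumes S: "x \<in> signed_ints n" "y \<in> signed_ints n" "x' \<in> signed_ints n" "y' \<in> signed_ints n"
    and ne: "\<bar>x\<bar> \<noteq> \<bar>y\<bar>" "\<bar>x'\<bar> \<noteq> \<bar>y'\<bar>"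
    and eq: "signed_vec n x + signed_vec n y = signed_vec n x' + signed_vec n y'"
  shows "x = x' \<and> y = y' \<or> x = y' \<and> y = x'"
proof -
  have mem: "z = z' \<or> z = w'" if "z \<in> signed_ints n" "w \<in> signed_ints n" "z' \<in> signed_ints n" "w' \<in> signed_ints n"
    "\<bar>z\<bar> \<noteq> \<bar>w\<bar>" "\<bar>z'\<bar> \<noteq> \<bar>w'\<bar>" "signed_vec n z + signed_vec n w = signed_vec n z' + signed_vec n w'" for z w z' w'
  proof -
    have lt: "nat \<bar>z\<bar> - 1 < n" "z \<noteq> 0" using that(1) by (auto simp: signed_ints_def)
    have "(signed_vec n z + signed_vec n w) $ (nat \<bar>z\<bar> - 1) = (signed_vec n z' + signed_vec n w') $ (nat \<bar>z\<bar> - 1)"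
      using that(7) by simp
    then have "(of_int (sgn z) :: real) = (if \<bar>z'\<bar> = \<bar>z\<bar> then of_int (sgn z') else 0) +
        (if \<bar>w'\<bar> = \<bar>z\<bar> then of_int (sgn w') else 0)"
      using lt that(5) by (simp add: signed_vec_index[OF that(1,1)] signed_vec_index[OF that(1,2)]
        signed_vec_index[OF that(1,3)] signed_vec_index[OF that(1,4)] del: One_nat_def)
    then show ?thesis using lt(2) that(6) by (auto simp: sgn_if split: if_splits)
  qed
  have "x = x' \<or> x = y'" by (rule mem[OF S ne eq])
  moreover have "y = x' \<or> y = y'"
    by (rule mem[OF S(2,1,3,4) _ ne(2)]) (use ne eq in \<open>auto simp: comm_add_vec[of _ n]\<close>)
  ultimately show ?thesis using ne by auto
qed

lemma signed_vec_inj: "inj_on (signed_vec n) (signed_ints n)"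
proof (rule inj_onI)
  fix x y assume h: "x \<in> signed_ints n" "y \<in> signed_ints n" "signed_vec n x = signed_vec n y"
  have "(of_int (sgn x) :: real) = (if \<bar>y\<bar> = \<bar>x\<bar> then of_int (sgn y) else 0)"
    using signed_vec_index[OF h(1,1)] signed_vec_index[OF h(1,2)] h(3) by simp
  moreover have "x \<noteq> 0" using h(1) by (simp add: signed_ints_def)
  ultimately show "x = y" by (auto simp: sgn_if split: if_splits)
qed

lemma signed_vec_image: "signed_vec n ` signed_ints n = signed_basis n"
proof (intro equalityI subsetI)
  fix v assume "v \<in> signed_vec n ` signed_ints n"
  then obtain x where x: "x \<in> signed_ints n" "v = signed_vec n x" by blast
  show "v \<in> signed_basis n"
  proof (cases "0 < x")
    case True
    then have "nat x \<in> {1..n}" using x by (auto simp: signed_ints_def)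
    then show ?thesis using x True by (auto simp: signed_basis_def signed_vec_def)
  next
    case False
    then have "nat (- x) \<in> {1..n}" using x by (auto simp: signed_ints_def)
    then show ?thesis using x False by (auto simp: signed_basis_def signed_vec_def)
  qed
next
  fix v assume "v \<in> signed_basis n"
  then obtain i where i: "i \<in> {1..n}" "v = std_basis n i \<or> v = - std_basis n i"
    by (auto simp: signed_basis_def)
  then have "v = signed_vec n (int i) \<or> v = signed_vec n (- int i)" by (auto simp: signed_vec_def)
  moreover have "int i \<in> signed_ints n" "- int i \<in> signed_ints n" using i by (auto simp: signed_ints_def)
  ultimately show "v \<in> signed_vec n ` signed_ints n" by blast
qed

lemma mult_signed_vec_uminus:
  assumes "A \<in> carrier_mat n n" "x \<in> signed_ints n"
  shows "A *\<^sub>v signed_vec n (- x) = - (A *\<^sub>v signed_vec n x)"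
proof -
  have "A *\<^sub>v - v = - (A *\<^sub>v v)" if "v \<in> carrier_vec n" for v
    using assms(1) that by (intro eq_vecI) auto
  then show ?thesis by (simp add: signed_vec_uminus[OF assms(2)])
qed

lemma mult_unit_vec:
  fixes A :: "real mat"
  assumes "A \<in> carrier_mat n n" "j < n"
  shows "A *\<^sub>v unit_vec n j = col A j"
  using assms by (intro eq_vecI) auto

section \<open>The group of type B as the odd bijections of the signed indices\<close>

lemma signed_mat_eqI:
  assumes "A \<in> carrier_mat n n" "B \<in> carrier_mat n n"
    and eq: "\<And>x. x \<in> signed_ints n \<Longrightarrow> A *\<^sub>v signed_vec n x = B *\<^sub>v signed_vec n x"
  shows "A = B"
proof (rule eq_matI)
  fix i j assume "i < dim_row B" "j < dim_col B"
  then have ij: "i < n" "j < n" using assms by auto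
  have "signed_vec n (int (Suc j)) = unit_vec n j" by (simp add: signed_vec_def std_basis_def del: of_nat_Suc)
  moreover have "int (Suc j) \<in> signed_ints n" using ij by (simp add: signed_ints_def)
  ultimately have "col A j = col B j" using eq[of "int (Suc j)"] mult_unit_vec assms ij by metis
  then show "A $$ (i, j) = B $$ (i, j)" using ij assms by (metis carrier_matD index_col)
qed (use assms in auto)

text \<open>\<open>signed_vec\<close> identifies signed indices with the signed basis, so the
  permutation of the basis by \<open>A\<close> is transported to \<open>a\<close>; linearity of
  \<open>A\<close> makes \<open>a\<close> odd.\<close>

lemma type_B_action:
  assumes "A \<in> carrier (type_B n)"
  shows "\<exists>a. odd_bij n a \<and> (\<forall>x\<in>signed_ints n. A *\<^sub>v signed_vec n x = signed_vec n (a x))"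
proof -
  have A: "A \<in> carrier_mat n n" "bij_betw (\<lambda>v. A *\<^sub>v v) (signed_basis n) (signed_basis n)"
    using assms by (auto simp: type_B_def)
  have bb: "bij_betw (signed_vec n) (signed_ints n) (signed_basis n)"
    by (simp add: bij_betw_def signed_vec_inj signed_vec_image)
  define a where "a = the_inv_into (signed_ints n) (signed_vec n) \<circ> ((\<lambda>v. A *\<^sub>v v) \<circ> signed_vec n)"
  have ba: "bij_betw a (signed_ints n) (signed_ints n)"
    unfolding a_def by (intro bij_betw_trans[OF _ bij_betw_the_inv_into[OF bb]] bij_betw_trans[OF bb A(2)])
  have act: "A *\<^sub>v signed_vec n x = signed_vec n (a x)" if "x \<in> signed_ints n" for x
  proof -
    have "A *\<^sub>v signed_vec n x \<in> signed_vec n ` signed_ints n"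
      using A(2) that signed_vec_image by (auto simp: bij_betw_def)
    then show ?thesis by (simp add: a_def f_the_inv_into_f[OF signed_vec_inj])
  qed
  have "a (- x) = - a x" if x: "x \<in> signed_ints n" for x
  proof -
    have ax: "a x \<in> signed_ints n" "a (- x) \<in> signed_ints n"
      using ba x signed_ints_uminus by (auto simp: bij_betw_def)
    have "signed_vec n (a (- x)) = signed_vec n (- a x)"
      using act[OF x] act[OF signed_ints_uminus[OF x]] mult_signed_vec_uminus[OF A(1) x]
        signed_vec_uminus[OF ax(1)] by simp
    then show ?thesis using inj_onD[OF signed_vec_inj] ax signed_ints_uminus by blast
  qed
  then show ?thesis using ba act by (auto simp: odd_bij_def)
qed

lemma type_B_memI:
  assumes A: "A \<in> carrier_mat n n" and a: "bij_betw a (signed_ints n) (signed_ints n)"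
    and act: "\<And>x. x \<in> signed_ints n \<Longrightarrow> A *\<^sub>v signed_vec n x = signed_vec n (a x)"
  shows "A \<in> carrier (type_B n)"
proof -
  have bb: "bij_betw (signed_vec n) (signed_ints n) (signed_basis n)"
    by (simp add: bij_betw_def signed_vec_inj signed_vec_image)
  have "bij_betw (signed_vec n \<circ> a) (signed_ints n) (signed_basis n)" by (rule bij_betw_trans[OF a bb])
  then have "bij_betw ((\<lambda>v. A *\<^sub>v v) \<circ> signed_vec n) (signed_ints n) (signed_basis n)"
    by (rule iffD1[OF bij_betw_cong, rotated]) (simp add: act)
  then have "bij_betw (\<lambda>v. A *\<^sub>v v) (signed_basis n) (signed_basis n)"
    using bij_betw_comp_iff[OF bb] by blast
  then show ?thesis using A by (simp add: type_B_def)
qed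

definition signed_mat :: "nat \<Rightarrow> (int \<Rightarrow> int) \<Rightarrow> real mat" where
  "signed_mat n a = mat_of_cols n (map (\<lambda>j. signed_vec n (a (int j))) [1..<Suc n])"

lemma mat_of_cols_std_basis:
  assumes "\<And>j. F j \<in> carrier_vec n" "j \<in> {1..n}"
  shows "mat_of_cols n (map F [1..<Suc n]) *\<^sub>v std_basis n j = F j"
proof -
  let ?A = "mat_of_cols n (map F [1..<Suc n])"
  have "?A \<in> carrier_mat n n" by (metis diff_Suc_1 length_map length_upt mat_of_cols_carrier(1))
  moreover have j: "j - 1 < n" using assms(2) by auto
  ultimately have "?A *\<^sub>v std_basis n j = col ?A (j - 1)"
    unfolding std_basis_def by (rule mult_unit_vec)
  also have "\<dots> = map F [1..<Suc n] ! (j - 1)"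
    using j assms(1) by (intro col_mat_of_cols) (auto simp del: upt_Suc)
  also have "\<dots> = F j" using j assms(2) by (simp del: upt_Suc)
  finally show ?thesis .
qed

lemma signed_mat_carrier: "signed_mat n a \<in> carrier_mat n n"
  unfolding signed_mat_def by (metis diff_Suc_1 length_map length_upt mat_of_cols_carrier(1))

lemma signed_mat_action:
  assumes a: "odd_bij n a" and x: "x \<in> signed_ints n"
  shows "signed_mat n a *\<^sub>v signed_vec n x = signed_vec n (a x)"
proof -
  have pos: "signed_mat n a *\<^sub>v signed_vec n x = signed_vec n (a x)" if "x \<in> signed_ints n" "0 < x" for x
  proof -
    have "nat x \<in> {1..n}" using that by (auto simp: signed_ints_def)
    from mat_of_cols_std_basis[of "\<lambda>j. signed_vec n (a (int j))", OF _ this]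
    show ?thesis using that by (simp add: signed_mat_def signed_vec_def[of n x] del: upt_Suc)
  qed
  show ?thesis
  proof (cases "0 < x")
    case False
    then have "0 < - x" using x by (auto simp: signed_ints_def)
    then show ?thesis
      using pos[OF signed_ints_uminus[OF x]] mult_signed_vec_uminus[OF signed_mat_carrier signed_ints_uminus[OF x], of a]
        odd_bijD[OF a x] signed_vec_uminus[of "a x" n] by simp
  qed (use pos x in simp)
qed

lemma odd_bij_inverse:
  assumes "odd_bij n a"
  shows "odd_bij n (inv_into (signed_ints n) a)"
proof -
  let ?b = "inv_into (signed_ints n) a"
  have ba: "bij_betw a (signed_ints n) (signed_ints n)" using assms by (simp add: odd_bij_def)
  have "?b (- x) = - ?b x" if x: "x \<in> signed_ints n" for x
  proof -
    have bx: "?b x \<in> signed_ints n" "a (?b x) = x"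
      using ba x by (auto simp: bij_betw_def inv_into_into f_inv_into_f)
    then have "a (- ?b x) = - x" using odd_bijD(2)[OF assms] by simp
    then show ?thesis
      using bx signed_ints_uminus ba by (metis bij_betw_inv_into_left)
  qed
  then show ?thesis using bij_betw_inv_into[OF ba] by (simp add: odd_bij_def)
qed

lemma signed_mat_in_type_B: "odd_bij n a \<Longrightarrow> signed_mat n a \<in> carrier (type_B n)"
  by (rule type_B_memI[OF signed_mat_carrier _ signed_mat_action]) (auto simp: odd_bij_def)

text \<open>A left inverse of \<open>x\<close> is the matrix of the inverse of the permutation that
  \<open>x\<close> induces on signed indices; the product is compared with the identity on signed
  basis vectors.\<close>

lemma group_type_B: "group (type_B n)"
proof (rule groupI)
  note sel = type_B_def monoid.simps partial_object.simps
  fix x assume x: "x \<in> carrier (type_B n)"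
  then obtain a where a: "odd_bij n a" "\<And>y. y \<in> signed_ints n \<Longrightarrow> x *\<^sub>v signed_vec n y = signed_vec n (a y)"
    using type_B_action by blast
  have xc: "x \<in> carrier_mat n n" using x by (simp add: type_B_def)
  let ?b = "inv_into (signed_ints n) a"
  have b: "odd_bij n ?b" by (rule odd_bij_inverse[OF a(1)])
  have "signed_mat n ?b * x = 1\<^sub>m n"
  proof (rule signed_mat_eqI)
    fix y assume y: "y \<in> signed_ints n"
    have "?b (a y) = y" using a(1) y by (simp add: odd_bij_def bij_betw_def)
    then show "signed_mat n ?b * x *\<^sub>v signed_vec n y = 1\<^sub>m n *\<^sub>v signed_vec n y"
      using a(2)[OF y] signed_mat_action[OF b odd_bijD(1)[OF a(1) y]]
      by (simp add: assoc_mult_mat_vec[OF signed_mat_carrier xc])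
  qed (use signed_mat_carrier[of n ?b] xc in auto)
  then show "\<exists>y\<in>carrier (type_B n). y \<otimes>\<^bsub>type_B n\<^esub> x = \<one>\<^bsub>type_B n\<^esub>"
    using signed_mat_in_type_B[OF b] by (auto simp: type_B_def intro!: bexI[of _ "signed_mat n ?b"])
next
  fix x y assume xy: "x \<in> carrier (type_B n)" "y \<in> carrier (type_B n)"
  then have c: "x \<in> carrier_mat n n" "y \<in> carrier_mat n n"
    "bij_betw (\<lambda>v. x *\<^sub>v v) (signed_basis n) (signed_basis n)" "bij_betw (\<lambda>v. y *\<^sub>v v) (signed_basis n) (signed_basis n)"
    by (auto simp: type_B_def)
  have sub: "signed_basis n \<subseteq> carrier_vec n" by (auto simp flip: signed_vec_image)
  have "bij_betw (\<lambda>v. (x * y) *\<^sub>v v) (signed_basis n) (signed_basis n)"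
    by (rule iffD1[OF bij_betw_cong bij_betw_trans[OF c(4,3)]]) (use sub c in auto)
  then show "x \<otimes>\<^bsub>type_B n\<^esub> y \<in> carrier (type_B n)" using c by (auto simp: type_B_def)
next
  have "bij_betw (\<lambda>v. 1\<^sub>m n *\<^sub>v v) (signed_basis n) (signed_basis n)"
    by (rule iffD1[OF bij_betw_cong bij_betw_id]) (auto simp flip: signed_vec_image)
  then show "\<one>\<^bsub>type_B n\<^esub> \<in> carrier (type_B n)" by (simp add: type_B_def)
qed (auto simp: type_B_def)

section \<open>Roots in terms of heights\<close>

definition weight :: "nat \<Rightarrow> real vec \<Rightarrow> real" where
  "weight n v = vec n (\<lambda>i. real (n - i)) \<bullet> v"

lemma weight_add: "v \<in> carrier_vec n \<Longrightarrow> w \<in> carrier_vec n \<Longrightarrow> weight n (v + w) = weight n v + weight n w"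
  unfolding weight_def by (rule scalar_prod_add_distrib) auto

lemma weight_uminus: "v \<in> carrier_vec n \<Longrightarrow> weight n (- v) = - weight n v"
  unfolding weight_def by simp

text \<open>The vector defining \<open>weight\<close> has coordinates n, n - 1, ..., 1 and is
  strictly dominant. The functional therefore separates positive from negative roots, and on a root
  it is a height or a sum of two heights.\<close>

lemma weight_signed_vec:
  assumes "x \<in> signed_ints n" shows "weight n (signed_vec n x) = of_int (height n x)"
proof -
  obtain i where i: "nat \<bar>x\<bar> - 1 = i" "i < n" "\<bar>x\<bar> = int i + 1"
    using assms by (intro that[of "nat \<bar>x\<bar> - 1"]) (auto simp: signed_ints_def)
  have E: "signed_vec n x = (if 0 < x then unit_vec n i else - unit_vec n i)" "x \<noteq> 0"
    using assms i(1) by (auto simp: signed_vec_def std_basis_def signed_ints_def)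
  have "weight n (unit_vec n i) = of_int (int n - int i)"
    using i(2) by (simp add: weight_def of_nat_diff)
  then show ?thesis using E i(3) weight_uminus[of "unit_vec n i" n]
    by (auto simp: height_def sgn_if)
qed

lemma height_uminus: "height n (- x) = - height n x"
  by (simp add: height_def)

lemma height_abs_inj:
  "x \<in> signed_ints n \<Longrightarrow> y \<in> signed_ints n \<Longrightarrow> \<bar>height n x\<bar> = \<bar>height n y\<bar> \<Longrightarrow> \<bar>x\<bar> = \<bar>y\<bar>"
  by (auto simp: height_def signed_ints_def abs_mult)

lemma height_nz: "x \<in> signed_ints n \<Longrightarrow> height n x \<noteq> 0"
  by (auto simp: height_def signed_ints_def sgn_if)

text \<open>Positivity is decided by the entry of smaller absolute value. The description is
  symmetric in \<open>x\<close> and \<open>y\<close>, which suits signed permutations, as they need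
  not preserve the order of absolute values.\<close>

lemma pos_long_roots_eq:
  "pos_long_roots n = {signed_vec n x + signed_vec n y | x y.
     x \<in> signed_ints n \<and> y \<in> signed_ints n \<and> \<bar>x\<bar> \<noteq> \<bar>y\<bar> \<and> 0 < height n x + height n y}" (is "_ = ?R")
proof (intro equalityI subsetI)
  fix v assume "v \<in> pos_long_roots n"
  then obtain i j where ij: "1 \<le> i" "i < j" "j \<le> n"
      "v = std_basis n i + std_basis n j \<or> v = std_basis n i - std_basis n j"
    by (auto simp: pos_long_roots_def)
  have "std_basis n i - std_basis n j = std_basis n i + - std_basis n j"
    by (intro eq_vecI) (auto simp: std_basis_def)
  then have "v = signed_vec n (int i) + signed_vec n (int j) \<or> v = signed_vec n (int i) + signed_vec n (- int j)"
    using ij by (auto simp: signed_vec_def)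
  moreover have "int i \<in> signed_ints n" "int j \<in> signed_ints n" "- int j \<in> signed_ints n"
    using ij by (auto simp: signed_ints_def)
  moreover have "0 < height n (int i) + height n (int j)" "0 < height n (int i) + height n (- int j)"
    using ij by (auto simp: height_def sgn_if)
  moreover have "\<bar>int i\<bar> \<noteq> \<bar>int j\<bar>" "\<bar>int i\<bar> \<noteq> \<bar>- int j\<bar>" using ij by auto
  ultimately show "v \<in> ?R" by blast
next
  have main: "signed_vec n x + signed_vec n y \<in> pos_long_roots n"
    if "x \<in> signed_ints n" "y \<in> signed_ints n" "\<bar>x\<bar> < \<bar>y\<bar>" "0 < height n x + height n y" for x y
  proof -
    have x: "0 < x"
      using that by (auto simp: height_def signed_ints_def sgn_if split: if_splits)
    have "std_basis n i + - std_basis n j = std_basis n i - std_basis n j" for i j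
      by (intro eq_vecI) (auto simp: std_basis_def)
    then have "signed_vec n x + signed_vec n y = std_basis n (nat x) + std_basis n (nat \<bar>y\<bar>) \<or>
        signed_vec n x + signed_vec n y = std_basis n (nat x) - std_basis n (nat \<bar>y\<bar>)"
      using x by (auto simp: signed_vec_def)
    moreover have "1 \<le> nat x \<and> nat x < nat \<bar>y\<bar> \<and> nat \<bar>y\<bar> \<le> n"
      using that x by (auto simp: signed_ints_def)
    ultimately show ?thesis unfolding pos_long_roots_def by blast
  qed
  fix v assume "v \<in> ?R"
  then obtain x y where v: "v = signed_vec n x + signed_vec n y" and xy: "x \<in> signed_ints n" "y \<in> signed_ints n"
    "\<bar>x\<bar> \<noteq> \<bar>y\<bar>" "0 < height n x + height n y" by blast
  then consider "\<bar>x\<bar> < \<bar>y\<bar>" | "\<bar>y\<bar> < \<bar>x\<bar>" by linarith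
  then show "v \<in> pos_long_roots n"
  proof cases
    case 1
    then show ?thesis using main xy v by simp
  next
    case 2
    then have "signed_vec n y + signed_vec n x \<in> pos_long_roots n" using main xy by simp
    then show ?thesis by (simp add: v comm_add_vec[of _ n])
  qed
qed

lemma pos_short_roots_eq:
  "pos_short_roots n = signed_vec n ` {x \<in> signed_ints n. 0 < height n x}"
proof -
  have "{x \<in> signed_ints n. 0 < height n x} = int ` {1..n}"
  proof (intro equalityI subsetI)
    fix x assume "x \<in> {x \<in> signed_ints n. 0 < height n x}"
    then have "nat x \<in> {1..n}" "x = int (nat x)"
      by (auto simp: signed_ints_def height_def sgn_if split: if_splits)
    then show "x \<in> int ` {1..n}" by blast
  qed (auto simp: signed_ints_def height_def sgn_if)
  moreover have "pos_short_roots n = std_basis n ` {1..n}" by (auto simp: pos_short_roots_def)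
  moreover have "std_basis n ` {1..n} = signed_vec n ` int ` {1..n}"
    unfolding image_image by (rule image_cong) (auto simp: signed_vec_def)
  ultimately show ?thesis by simp
qed

lemma weight_pos_roots: "v \<in> pos_roots n \<Longrightarrow> v \<in> carrier_vec n \<and> 0 < weight n v"
  unfolding pos_roots_def pos_long_roots_eq pos_short_roots_eq
  by (auto simp: weight_add weight_signed_vec simp flip: of_int_add)

lemma weight_neg_roots: "v \<in> neg_roots n \<Longrightarrow> weight n v < 0"
  unfolding neg_roots_def using weight_pos_roots by (auto simp: weight_uminus)

text \<open>One direction evaluates \<open>weight\<close>; for the other, negating both entries
  gives a positive root.\<close>

lemma long_root_neg_iff:
  assumes "x \<in> signed_ints n" "y \<in> signed_ints n" "\<bar>x\<bar> \<noteq> \<bar>y\<bar>"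
  shows "signed_vec n x + signed_vec n y \<in> neg_roots n \<longleftrightarrow> height n x + height n y < 0"
proof
  assume "signed_vec n x + signed_vec n y \<in> neg_roots n"
  from weight_neg_roots[OF this] show "height n x + height n y < 0"
    using assms by (simp add: weight_add weight_signed_vec flip: of_int_add)
next
  assume "height n x + height n y < 0"
  then have "signed_vec n (- x) + signed_vec n (- y) \<in> pos_long_roots n"
    using assms signed_ints_uminus unfolding pos_long_roots_eq
    by (intro CollectI exI[of _ "- x"] exI[of _ "- y"]) (auto simp: height_uminus)
  moreover have "signed_vec n x + signed_vec n y = - (signed_vec n (- x) + signed_vec n (- y))"
    using assms by (intro eq_vecI) (auto simp: signed_vec_uminus)
  ultimately show "signed_vec n x + signed_vec n y \<in> neg_roots n"
    by (auto simp: neg_roots_def pos_roots_def)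
qed

lemma short_root_neg_iff:
  assumes "x \<in> signed_ints n"
  shows "signed_vec n x \<in> neg_roots n \<longleftrightarrow> height n x < 0"
proof
  assume "signed_vec n x \<in> neg_roots n"
  from weight_neg_roots[OF this] show "height n x < 0"
    using assms by (simp add: weight_signed_vec)
next
  assume "height n x < 0"
  then have "signed_vec n (- x) \<in> pos_short_roots n"
    using assms signed_ints_uminus unfolding pos_short_roots_eq by (auto simp: height_uminus)
  moreover have "signed_vec n x = - signed_vec n (- x)"
    using assms by (simp add: signed_vec_uminus)
  ultimately show "signed_vec n x \<in> neg_roots n"
    by (auto simp: neg_roots_def pos_roots_def)
qed

lemma finite_pos_roots: "finite (pos_long_roots n)" "finite (pos_short_roots n)"
proof -
  have "pos_long_roots n \<subseteq> (\<lambda>(x, y). signed_vec n x + signed_vec n y) ` (signed_ints n \<times> signed_ints n)"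
    unfolding pos_long_roots_eq by auto
  then show "finite (pos_long_roots n)" by (rule finite_subset) (simp add: finite_signed_ints)
  show "finite (pos_short_roots n)" unfolding pos_short_roots_eq by (simp add: finite_signed_ints)
qed

text \<open>Here \<open>\<gamma>\<close> describes the conjugating element and \<open>- f\<close> the conjugated one; the flips of \<open>f\<close>
  correspond to the positive roots that \<open>v\<close> keeps positive.\<close>

lemma card_roots_conj:
  fixes \<gamma> f :: "int \<Rightarrow> int"
  assumes v: "v \<in> carrier_mat n n" and g: "odd_bij n \<gamma>" and f: "odd_bij n f"
    and act: "\<And>x. x \<in> signed_ints n \<Longrightarrow> v *\<^sub>v signed_vec n (\<gamma> x) = signed_vec n (- \<gamma> (f x))"
  defines "G \<equiv> \<lambda>x. height n (\<gamma> x)" and "I \<equiv> signed_ints n"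
  shows "card (Lambda n v) + card {(p, q) \<in> flips f G I I. \<bar>p\<bar> < \<bar>q\<bar>} = card (pos_long_roots n)"
    and "card (Sigma_short n v) + card {p \<in> I. 0 < G p \<and> G (f p) < 0} = card (pos_short_roots n)"
proof -
  let ?D = "{(p, q) \<in> flips f G I I. \<bar>p\<bar> < \<bar>q\<bar>}" and ?E = "signed_vec n"
  let ?F = "\<lambda>(p, q). ?E (\<gamma> p) + ?E (\<gamma> q)"
  have gI: "\<gamma> p \<in> I" "- \<gamma> p \<in> I" and fI: "f p \<in> I" if "p \<in> I" for p
    using that odd_bijD(1)[OF g] odd_bijD(1)[OF f] signed_ints_uminus by (auto simp: I_def)
  have gabs: "\<bar>\<gamma> p\<bar> \<noteq> \<bar>\<gamma> q\<bar>" and fabs: "\<bar>f p\<bar> \<noteq> \<bar>f q\<bar>" if "p \<in> I" "q \<in> I" "\<bar>p\<bar> \<noteq> \<bar>q\<bar>" for p q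
    using that odd_bij_abs_inj[OF g] odd_bij_abs_inj[OF f] unfolding I_def by blast+
  have ginj: "p = q" if "p \<in> I" "q \<in> I" "\<gamma> p = \<gamma> q" for p q
    using g that by (auto simp: odd_bij_def bij_betw_def I_def dest: inj_onD)
  have gsurj: "\<exists>p\<in>I. x = \<gamma> p" if "x \<in> I" for x
    using g that by (auto simp: odd_bij_def bij_betw_def I_def)
  \<comment> \<open>Indices of distinct absolute value have heights of distinct absolute value. So
    the sum of heights cannot vanish, and not being negative means being positive.\<close>
  have keep: "v *\<^sub>v (?E (\<gamma> p) + ?E (\<gamma> q)) \<notin> neg_roots n \<longleftrightarrow> G (f p) + G (f q) < 0"
    if pq: "p \<in> I" "q \<in> I" "\<bar>p\<bar> \<noteq> \<bar>q\<bar>" for p q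
  proof -
    have "\<bar>G (f p)\<bar> \<noteq> \<bar>G (f q)\<bar>"
      using height_abs_inj[of "\<gamma> (f p)" n "\<gamma> (f q)"] gabs[OF fI fI fabs] pq gI fI
      by (auto simp: G_def I_def)
    then have "G (f p) + G (f q) \<noteq> 0" by linarith
    moreover have "v *\<^sub>v (?E (\<gamma> p) + ?E (\<gamma> q)) = ?E (- \<gamma> (f p)) + ?E (- \<gamma> (f q))"
      using pq act by (simp add: mult_add_distrib_mat_vec[OF v] I_def)
    moreover have "\<dots> \<in> neg_roots n \<longleftrightarrow> height n (- \<gamma> (f p)) + height n (- \<gamma> (f q)) < 0"
      using gabs[OF fI fI fabs] pq gI fI by (intro long_root_neg_iff) (auto simp: I_def)
    ultimately show ?thesis by (auto simp: height_uminus G_def)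
  qed
  \<comment> \<open>Each root comes from both \<open>(p, q)\<close> and \<open>(q, p)\<close>, of
    which the condition on absolute values selects one. The condition is put on \<open>p\<close> and
    \<open>q\<close> themselves, since \<open>\<gamma>\<close> may reverse the order of absolute
    values.\<close>
  have "pos_long_roots n - Lambda n v = ?F ` ?D"
  proof (intro equalityI subsetI)
    fix \<alpha> assume a: "\<alpha> \<in> pos_long_roots n - Lambda n v"
    then obtain x y where xy: "x \<in> I" "y \<in> I" "\<bar>x\<bar> \<noteq> \<bar>y\<bar>" "0 < height n x + height n y" "\<alpha> = ?E x + ?E y"
      by (auto simp: pos_long_roots_eq I_def)
    then obtain p q where pq: "p \<in> I" "x = \<gamma> p" "q \<in> I" "y = \<gamma> q" using gsurj by blast
    have ne: "\<bar>p\<bar> \<noteq> \<bar>q\<bar>"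
    proof
      assume "\<bar>p\<bar> = \<bar>q\<bar>"
      then have "p = q \<or> p = - q" by auto
      then show False using xy pq odd_bijD(2)[OF g, of q] by (auto simp: I_def)
    qed
    have "v *\<^sub>v \<alpha> \<notin> neg_roots n" using a by (auto simp: Lambda_def)
    then have neg: "G (f p) + G (f q) < 0" using keep[OF pq(1,3) ne] xy pq by simp
    consider "\<bar>p\<bar> < \<bar>q\<bar>" | "\<bar>q\<bar> < \<bar>p\<bar>" using ne by linarith
    then show "\<alpha> \<in> ?F ` ?D"
    proof cases
      case 1
      then show ?thesis using xy pq neg by (intro image_eqI[of _ _ "(p, q)"]) (auto simp: flips_def G_def)
    next
      case 2
      then show ?thesis using xy pq neg
        by (intro image_eqI[of _ _ "(q, p)"]) (auto simp: flips_def G_def comm_add_vec[of _ n])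
    qed
  next
    fix \<alpha> assume "\<alpha> \<in> ?F ` ?D"
    then obtain p q where pq: "p \<in> I" "q \<in> I" "\<bar>p\<bar> < \<bar>q\<bar>" "0 < G p + G q" "G (f p) + G (f q) < 0"
      "\<alpha> = ?E (\<gamma> p) + ?E (\<gamma> q)" by (auto simp: flips_def)
    then have "\<alpha> \<in> pos_long_roots n"
      using gI gabs[of p q] unfolding pos_long_roots_eq G_def I_def by force
    moreover have "v *\<^sub>v \<alpha> \<notin> neg_roots n" using keep[of p q] pq by simp
    ultimately show "\<alpha> \<in> pos_long_roots n - Lambda n v" by (simp add: Lambda_def)
  qed
  moreover have "inj_on ?F ?D"
  proof (rule inj_onI)
    fix z z' assume z: "z \<in> ?D" "z' \<in> ?D" "?F z = ?F z'"
    obtain p q p' q' where zz: "z = (p, q)" "z' = (p', q')" by (meson surj_pair)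
    have h: "(p, q) \<in> flips f G I I" "\<bar>p\<bar> < \<bar>q\<bar>" "(p', q') \<in> flips f G I I" "\<bar>p'\<bar> < \<bar>q'\<bar>"
      "?E (\<gamma> p) + ?E (\<gamma> q) = ?E (\<gamma> p') + ?E (\<gamma> q')" using z zz by auto
    then have I: "p \<in> I" "q \<in> I" "p' \<in> I" "q' \<in> I" by (auto simp: flips_def)
    have "\<gamma> p = \<gamma> p' \<and> \<gamma> q = \<gamma> q' \<or> \<gamma> p = \<gamma> q' \<and> \<gamma> q = \<gamma> p'"
      using gI[OF I(1)] gI[OF I(2)] gI[OF I(3)] gI[OF I(4)] gabs[of p q] gabs[of p' q'] h I
      by (intro signed_vec_sum_inj) (auto simp: I_def)
    then have "p = p' \<and> q = q' \<or> p = q' \<and> q = p'" using ginj I by blast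
    then show "z = z'" using h zz by auto
  qed
  ultimately have "card (pos_long_roots n - Lambda n v) = card ?D" by (simp add: card_image)
  moreover have "Lambda n v \<subseteq> pos_long_roots n" by (auto simp: Lambda_def)
  ultimately show "card (Lambda n v) + card ?D = card (pos_long_roots n)"
    using finite_pos_roots(1)[of n] by (metis card_Diff_subset card_mono finite_subset le_add_diff_inverse)

  let ?S = "{p \<in> I. 0 < G p \<and> G (f p) < 0}"
  have keep: "v *\<^sub>v ?E (\<gamma> p) \<notin> neg_roots n \<longleftrightarrow> G (f p) < 0" if p: "p \<in> I" for p
  proof -
    have "v *\<^sub>v ?E (\<gamma> p) \<in> neg_roots n \<longleftrightarrow> height n (- \<gamma> (f p)) < 0"
      using p act gI(2)[OF fI[OF p]] by (simp add: short_root_neg_iff I_def)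
    moreover have "G (f p) \<noteq> 0" using height_nz gI(1)[OF fI[OF p]] by (simp add: G_def I_def)
    ultimately show ?thesis by (auto simp: height_uminus G_def)
  qed
  have "pos_short_roots n - Sigma_short n v = (\<lambda>p. ?E (\<gamma> p)) ` ?S"
  proof (intro equalityI subsetI)
    fix \<alpha> assume a: "\<alpha> \<in> pos_short_roots n - Sigma_short n v"
    then obtain x where x: "x \<in> I" "0 < height n x" "\<alpha> = ?E x"
      by (auto simp: pos_short_roots_eq I_def)
    then obtain p where p: "p \<in> I" "x = \<gamma> p" using gsurj by blast
    have "v *\<^sub>v \<alpha> \<notin> neg_roots n" using a by (auto simp: Sigma_short_def)
    then have "G (f p) < 0" using keep[OF p(1)] x p by simp
    then show "\<alpha> \<in> (\<lambda>p. ?E (\<gamma> p)) ` ?S" using x p by (auto simp: G_def)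
  next
    fix \<alpha> assume "\<alpha> \<in> (\<lambda>p. ?E (\<gamma> p)) ` ?S"
    then obtain p where p: "p \<in> I" "0 < G p" "G (f p) < 0" "\<alpha> = ?E (\<gamma> p)" by auto
    then have "\<alpha> \<in> pos_short_roots n"
      using gI unfolding pos_short_roots_eq G_def I_def by blast
    moreover have "v *\<^sub>v \<alpha> \<notin> neg_roots n" using keep[of p] p by simp
    ultimately show "\<alpha> \<in> pos_short_roots n - Sigma_short n v" by (simp add: Sigma_short_def)
  qed
  moreover have "inj_on (\<lambda>p. ?E (\<gamma> p)) ?S"
    by (rule inj_onI) (use ginj gI inj_onD[OF signed_vec_inj] in \<open>auto simp: I_def\<close>)
  ultimately have "card (pos_short_roots n - Sigma_short n v) = card ?S" by (simp add: card_image)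
  moreover have "Sigma_short n v \<subseteq> pos_short_roots n" by (auto simp: Sigma_short_def)
  ultimately show "card (Sigma_short n v) + card ?S = card (pos_short_roots n)"
    using finite_pos_roots(2)[of n] by (metis card_Diff_subset card_mono finite_subset le_add_diff_inverse)
qed

section \<open>The matrices \<open>w\<^sub>\<lambda>\<^sub>,\<^sub>\<rho>\<close>\<close>

lemma mu_Suc: "k \<le> length lam \<Longrightarrow> mu lam (Suc k) = start lam k"
proof -
  assume k: "k \<le> length lam"
  have "mu lam (Suc k) = (\<Sum>j<k. lam ! j)"
    unfolding mu_def by (rule sum.reindex_bij_witness[of _ Suc "\<lambda>j. j - 1"]) auto
  also have "\<dots> = start lam k"
    using k by (simp add: start_def sum_list_sum_nth atLeast0LessThan)
  finally show ?thesis .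
qed

lemma signed_cycle_image_nth:
  assumes "distinct (map fst c)" "r < length c"
  shows "signed_cycle_image n c (fst (c ! r)) =
    snd (c ! r) \<cdot>\<^sub>v std_basis n (fst (c ! (Suc r mod length c)))"
proof -
  let ?z = "zip (map snd c) (rotate1 (map fst c))"
  have "map_of (zip (map fst c) ?z) (map fst c ! r) = Some (?z ! r)"
    by (rule map_of_zip_nth) (use assms in simp_all)
  moreover have "Suc r mod length c < length c" using assms(2) by (intro mod_less_divisor) auto
  then have "?z ! r = (snd (c ! r), fst (c ! (Suc r mod length c)))"
    using assms(2) by (simp add: nth_rotate1)
  ultimately show ?thesis using assms(2) by (simp add: signed_cycle_image_def)
qed

lemma signed_cycle_image_other:
  assumes "k \<notin> fst ` set c"
  shows "signed_cycle_image n c k = std_basis n k"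
proof -
  have "map_of (zip (map fst c) (zip (map snd c) (rotate1 (map fst c)))) k = None"
    using assms by (subst map_of_zip_is_None) simp_all
  then show ?thesis unfolding signed_cycle_image_def by (simp only: option.case)
qed

lemma signed_cycle_image_carrier: "signed_cycle_image n c k \<in> carrier_vec n"
proof (cases "map_of (zip (map fst c) (zip (map snd c) (rotate1 (map fst c)))) k")
  case (Some p)
  then show ?thesis by (cases p) (simp add: signed_cycle_image_def std_basis_def del: map_of_eq_Some_iff)
next
  case None
  then show ?thesis unfolding signed_cycle_image_def by (simp only: option.case std_basis_def unit_vec_carrier)
qed

lemma w_cycle_carrier: "w_cycle n lam rho i \<in> carrier_mat n n"
proof -
  have "mat_of_cols n (map F [1..<Suc n]) \<in> carrier_mat n n" for F :: "nat \<Rightarrow> real vec"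
    by (metis diff_Suc_1 length_map length_upt mat_of_cols_carrier(1))
  then show ?thesis by (simp only: w_cycle_def signed_cycle_def)
qed

text \<open>Both sides are odd in \<open>x\<close>, so positive \<open>x\<close> suffice; for these
  the image is read off the list \<open>c\<close> at the offset \<open>r\<close> of \<open>x\<close>
  in its block.\<close>

lemma w_cycle_action:
  assumes n: "sum_list lam = n" and k: "k < length lam" and x: "x \<in> signed_ints n"
  shows "w_cycle n lam rho (Suc k) *\<^sub>v signed_vec n x =
    signed_vec n (if x \<in> block_set lam k then - cyc lam rho x else x)"
proof -
  let ?s = "start lam k" and ?e = "start lam (Suc k)"
  define c where "c = map (\<lambda>j. (j, if rho < Suc k \<and> j = ?e then 1 else - 1 :: real)) [?s + 1..<?e + 1]"
  have mu: "mu lam (Suc k) = ?s" "mu lam (Suc k + 1) = ?e"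
    using mu_Suc[of k lam] mu_Suc[of "Suc k" lam] k by simp_all
  have wc: "w_cycle n lam rho (Suc k) = signed_cycle n c"
    unfolding w_cycle_def mu c_def by simp
  have e: "?e = ?s + lam ! k" by (rule start_Suc[OF k])
  have len: "length c = lam ! k" by (simp add: c_def e)
  have fsts: "map fst c = [?s + 1..<?e + 1]" unfolding c_def map_map comp_def fst_conv by (rule list.map_ident)
  have cnth: "c ! r = (?s + 1 + r, if rho < Suc k \<and> Suc r = lam ! k then 1 else - 1)" if "r < lam ! k" for r
    using that unfolding c_def by (subst nth_map) (auto simp: e simp del: upt_Suc)
  have pos: "w_cycle n lam rho (Suc k) *\<^sub>v signed_vec n x =
      signed_vec n (if x \<in> block_set lam k then - cyc lam rho x else x)"
    if x: "x \<in> signed_ints n" "0 < x" for x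
  proof -
    have "nat x \<in> {1..n}" using x by (auto simp: signed_ints_def)
    then have act: "w_cycle n lam rho (Suc k) *\<^sub>v signed_vec n x = signed_cycle_image n c (nat x)"
      using mat_of_cols_std_basis[OF signed_cycle_image_carrier] x(2)
      unfolding wc signed_cycle_def by (simp add: signed_vec_def)
    show ?thesis
    proof (cases "x \<in> block_set lam k")
      case True
      define r where "r = nat x - ?s - 1"
      have r: "r < lam ! k" "x = int (?s + 1 + r)" "nat x = ?s + 1 + r"
        using True x(2) e by (auto simp: r_def block_set_def)
      have "signed_cycle_image n c (nat x) = snd (c ! r) \<cdot>\<^sub>v std_basis n (fst (c ! (Suc r mod lam ! k)))"
        using signed_cycle_image_nth[of c r n] r len cnth[OF r(1)] fsts by (simp del: upt_Suc)
      also have "\<dots> = signed_vec n (- cyc lam rho x)"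
      proof (cases "Suc r < lam ! k")
        case S: True
        have "cyc lam rho x = int (?s + 1 + Suc r)" unfolding cyc_eq[OF True] using r(2) S e by simp
        then have "signed_vec n (- cyc lam rho x) = - std_basis n (?s + 1 + Suc r)"
          by (simp add: signed_vec_def del: of_nat_Suc of_nat_add)
        moreover have "- v = (- 1) \<cdot>\<^sub>v v" for v :: "real vec" by (intro eq_vecI) auto
        ultimately show ?thesis using S cnth[OF r(1)] cnth[OF S] by simp
      next
        case False
        then have S: "Suc r = lam ! k" using r by simp
        have "cyc lam rho x = cycle_sign rho k * int (?s + 1)"
          unfolding cyc_eq[OF True] using r(2) S e by simp
        \<comment> \<open>At the end of the block the sign is \<open>- cycle_sign rho k\<close>,
          which is 1 exactly if \<open>rho < Suc k\<close>, in agreement with the last entry of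
          \<open>c\<close>.\<close>
        then have "signed_vec n (- cyc lam rho x) =
            (if rho < Suc k then 1 else - 1) \<cdot>\<^sub>v std_basis n (?s + 1)"
          by (auto simp: signed_vec_def cycle_sign_def nat_add_distrib)
        moreover have "0 < lam ! k" using r(1) by simp
        ultimately show ?thesis using S cnth[OF r(1)] cnth[of 0] by simp
      qed
      finally show ?thesis using act True by simp
    next
      case False
      have "nat x \<notin> set (map fst c)" unfolding fsts using False x(2) by (auto simp: block_set_def)
      then have "signed_cycle_image n c (nat x) = std_basis n (nat x)"
        by (intro signed_cycle_image_other) simp
      then show ?thesis using act False x(2) by (simp add: signed_vec_def)
    qed
  qed
  show ?thesis
  proof (cases "0 < x")
    case False
    then have x': "- x \<in> signed_ints n" "0 < - x" using x by (auto simp: signed_ints_def)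
    have "w_cycle n lam rho (Suc k) *\<^sub>v signed_vec n x = - (w_cycle n lam rho (Suc k) *\<^sub>v signed_vec n (- x))"
      using mult_signed_vec_uminus[OF w_cycle_carrier x'(1)] by simp
    also have "\<dots> = - signed_vec n (if x \<in> block_set lam k then cyc lam rho x else - x)"
      using pos[OF x'] block_set_sym[of x lam k] block_set_sym[of "- x" lam k] by (auto simp: cyc_odd)
    also have "\<dots> = signed_vec n (if x \<in> block_set lam k then - cyc lam rho x else x)"
    proof -
      have "(if x \<in> block_set lam k then cyc lam rho x else - x) \<in> signed_ints n"
        using cyc_block_set block_set_subset[of lam k] x' n by auto
      from signed_vec_uminus[OF this] show ?thesis by (simp split: if_splits)
    qed
    finally show ?thesis .
  qed (use pos x in simp)
qed

text \<open>The factors are supported on disjoint blocks, so on \<open>x\<close> only the factor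
  belonging to its own block can act nontrivially.\<close>

lemma w_elt_action:
  assumes n: "sum_list lam = n"
  shows "w_elt n lam rho \<in> carrier_mat n n"
    and "x \<in> signed_ints n \<Longrightarrow> w_elt n lam rho *\<^sub>v signed_vec n x = signed_vec n (- cyc lam rho x)"
proof -
  let ?P = "\<lambda>ks. foldr (*) (map (w_cycle n lam rho) ks) (1\<^sub>m n)"
  have P: "?P ks \<in> carrier_mat n n" for ks
  proof (induction ks)
    case (Cons k ks)
    then show ?case using mult_carrier_mat[OF w_cycle_carrier Cons.IH] by simp
  qed simp
  \<comment> \<open>Generalised for the induction to lists of distinct factors: \<open>x\<close> has
    been moved according to \<open>cyc\<close> once the factor of its block occurs in the
    list.\<close>
  have act: "?P ks *\<^sub>v signed_vec n x = signed_vec n (if Suc (block lam (nat \<bar>x\<bar>)) \<in> set ks then - cyc lam rho x else x)"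
    if "x \<in> signed_ints n" "distinct ks" "set ks \<subseteq> {1..length lam}" for x ks
    using that(2,3)
  proof (induction ks)
    case (Cons i ks)
    let ?b = "block lam (nat \<bar>x\<bar>)" and ?c = "- cyc lam rho x"
    have b: "?b < length lam" "x \<in> block_set lam ?b" using signed_ints_block[of x lam] that(1) n by auto
    have c: "?c \<in> block_set lam ?b" using block_set_sym[OF cyc_block_set[OF b(2)]] .
    then have cI: "?c \<in> signed_ints n" using block_set_subset n by blast
    obtain k where k: "i = Suc k" "k < length lam" using Cons.prems by (cases i) auto
    have "?P (i # ks) *\<^sub>v signed_vec n x = w_cycle n lam rho i *\<^sub>v (?P ks *\<^sub>v signed_vec n x)"
      by (simp add: assoc_mult_mat_vec[OF w_cycle_carrier P])
    also have "\<dots> = w_cycle n lam rho (Suc k) *\<^sub>v signed_vec n (if Suc ?b \<in> set ks then ?c else x)"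
      using Cons k by simp
    also have "\<dots> = signed_vec n (if Suc ?b \<in> set (i # ks) then ?c else x)"
    proof (cases "Suc ?b \<in> set ks")
      case True
      then have "?b \<noteq> k" using Cons.prems k by auto
      then have "?c \<notin> block_set lam k" using block_of_block_set[OF c] block_of_block_set[of ?c lam k] by auto
      then show ?thesis using w_cycle_action[OF n k(2) cI] True by simp
    next
      case False
      have "x \<in> block_set lam k \<longleftrightarrow> ?b = k" using block_of_block_set[of x lam k] b(2) by auto
      then show ?thesis using w_cycle_action[OF n k(2) that(1)] False k by auto
    qed
    finally show ?case .
  qed simp
  show "w_elt n lam rho \<in> carrier_mat n n" unfolding w_elt_def by (rule P)
  assume x: "x \<in> signed_ints n"
  have "Suc (block lam (nat \<bar>x\<bar>)) \<in> set [1..<length lam + 1]"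
    using signed_ints_block(1)[of x lam] x n by auto
  moreover have "set [1..<length lam + 1] \<subseteq> {1..length lam}" by auto
  ultimately show "w_elt n lam rho *\<^sub>v signed_vec n x = signed_vec n (- cyc lam rho x)"
    unfolding w_elt_def by (subst act[OF x]) (simp_all del: upt_Suc)
qed

section \<open>Conjugacy classes\<close>

text \<open>Cycles are removed one at a time: a point and the least positive exponent returning it
  up to sign span a set stable under \<open>f\<close> and negation, and so is its complement. The
  cardinality clause later shows that the cycle lengths sum to \<open>n\<close>.\<close>

lemma orbit_decomposition:
  fixes f :: "int \<Rightarrow> int"
  assumes "finite X" "inj_on f X" "f ` X \<subseteq> X" "uminus ` X \<subseteq> X" "0 \<notin> X"
    and "\<And>x. x \<in> X \<Longrightarrow> f (- x) = - f x"
  shows "\<exists>xs. (\<forall>(m, a)\<in>set xs. m \<in> X \<and> 0 < a \<and> ((f ^^ a) m = m \<or> (f ^^ a) m = - m)) \<and>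
    (\<forall>y\<in>X. \<exists>(m, a)\<in>set xs. \<exists>r<a. y = (f ^^ r) m \<or> y = - (f ^^ r) m) \<and>
    card X = 2 * sum_list (map snd xs)"
  using assms
proof (induction X rule: finite_psubset_induct)
  case (psubset X)
  note inj = psubset.prems(1) and cl = psubset.prems(2) and sym = psubset.prems(3)
    and odd = psubset.prems(5)
  show ?case
  proof (cases "X = {}")
    case True
    then show ?thesis by (intro exI[of _ "[]"]) simp
  next
    case False
    then obtain x where x: "x \<in> X" by blast
    have ft: "(f ^^ t) y \<in> X" if "y \<in> X" for t y by (rule funpow_closed[OF cl that])
    have fodd: "(f ^^ t) (- y) = - (f ^^ t) y" if "y \<in> X" for t y
      by (induction t) (use odd[OF ft[OF that]] in auto)
    have finj: "y = z" if "(f ^^ t) y = (f ^^ t) z" "y \<in> X" "z \<in> X" for t y z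
      using that by (induction t) (use inj ft in \<open>auto dest: inj_onD\<close>)
    let ?P = "\<lambda>a. 0 < a \<and> ((f ^^ a) x = x \<or> (f ^^ a) x = - x)"
    \<comment> \<open>By finiteness two iterates coincide, and cancelling the common power of
      \<open>f\<close> shows that \<open>x\<close> is periodic.\<close>
    have "\<not> inj (\<lambda>t. (f ^^ t) x)"
    proof
      assume "inj (\<lambda>t. (f ^^ t) x)"
      moreover have "finite (range (\<lambda>t. (f ^^ t) x))"
        by (rule finite_subset[OF _ psubset.hyps]) (use ft x in auto)
      ultimately show False using finite_imageD infinite_UNIV_nat by blast
    qed
    then obtain s t where st: "s < t" "(f ^^ s) x = (f ^^ t) x"
      unfolding inj_def by (metis linorder_neqE_nat)
    then have "(f ^^ t) x = (f ^^ s) ((f ^^ (t - s)) x)"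
      by (metis comp_apply funpow_add le_add_diff_inverse less_imp_le)
    then have "(f ^^ (t - s)) x = x" using finj[of s x] st(2) x ft by metis
    then have "\<exists>a. ?P a" using st(1) by (intro exI[of _ "t - s"]) simp
    define a where "a = (LEAST a. ?P a)"
    have a: "?P a" unfolding a_def by (rule LeastI_ex) fact
    have least: "a \<le> b" if "?P b" for b unfolding a_def by (rule Least_le) (rule that)
    \<comment> \<open>Cancelling \<open>f ^^ r\<close> in a coincidence up to sign would make the
      exponent \<open>r' - r < a\<close> satisfy \<open>?P\<close>, against the choice of
      \<open>a\<close>.\<close>
    have ne: "(f ^^ r) x \<noteq> (f ^^ r') x \<and> (f ^^ r) x \<noteq> - (f ^^ r') x" if "r < r'" "r' < a" for r r'
    proof -
      let ?y = "(f ^^ (r' - r)) x"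
      have r': "(f ^^ r') x = (f ^^ r) ?y"
        using that(1) by (metis comp_apply funpow_add le_add_diff_inverse less_imp_le)
      have y: "?y \<in> X" "- ?y \<in> X" using ft[OF x] sym by blast+
      have "\<not> ?P (r' - r)" using least[of "r' - r"] that by linarith
      then have "x \<noteq> ?y" "x \<noteq> - ?y" using that by auto
      then show ?thesis using finj[of r x ?y] finj[of r x "- ?y"] fodd[OF y(1), of r] x y r' by auto
    qed
    define B where "B = (\<lambda>(r, s). s * (f ^^ r) x) ` ({..<a} \<times> {1, -1})"
    have Bmem: "y \<in> B \<longleftrightarrow> (\<exists>r<a. y = (f ^^ r) x \<or> y = - (f ^^ r) x)" for y
      by (force simp: B_def)
    have "inj_on (\<lambda>(r, s). s * (f ^^ r) x) ({..<a} \<times> {1, -1})"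
    proof (rule inj_onI)
      fix z z' assume z: "z \<in> {..<a} \<times> {1, -1}" "z' \<in> {..<a} \<times> {1, -1}"
        "(case z of (r, s) \<Rightarrow> s * (f ^^ r) x) = (case z' of (r, s) \<Rightarrow> s * (f ^^ r) x)"
      obtain r s r' s' where zz: "z = (r, s)" "z' = (r', s')" by (meson surj_pair)
      have h: "r \<in> {..<a}" "r' \<in> {..<a}" "s \<in> {1, -1}" "s' \<in> {1, -1}"
        "s * (f ^^ r) x = s' * (f ^^ r') x" using z zz by auto
      then have "(f ^^ r) x = (f ^^ r') x \<or> (f ^^ r) x = - (f ^^ r') x" by auto
      moreover have "(f ^^ r') x = (f ^^ r) x \<or> (f ^^ r') x = - (f ^^ r) x" using h by auto
      ultimately have "r = r'" using ne[of r r'] ne[of r' r] h(1,2)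
        by (metis lessThan_iff linorder_neqE_nat)
      moreover have "(f ^^ r) x \<noteq> 0" using ft[OF x] psubset.prems(4) by metis
      ultimately show "z = z'" using h zz by simp
    qed
    then have cardB: "card B = 2 * a" by (simp add: B_def card_image card_cartesian_product)
    have BX: "B \<subseteq> X"
    proof
      fix y assume "y \<in> B"
      then obtain r where "y = (f ^^ r) x \<or> y = - (f ^^ r) x" by (auto simp: Bmem)
      then show "y \<in> X" using ft[OF x, of r] sym by auto
    qed
    have finB: "finite B" by (rule finite_subset[OF BX psubset.hyps])
    have fB: "f ` B \<subseteq> B"
    proof clarify
      fix y assume "y \<in> B"
      then obtain r where r: "r < a" "y = (f ^^ r) x \<or> y = - (f ^^ r) x" by (auto simp: Bmem)
      then have fy: "f y = (f ^^ Suc r) x \<or> f y = - (f ^^ Suc r) x" using odd[OF ft[OF x]] by auto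
      show "f y \<in> B"
      proof (cases "Suc r < a")
        case True
        then show ?thesis using fy unfolding Bmem by blast
      next
        case False
        then have "Suc r = a" using r by simp
        then have "f y = x \<or> f y = - x" using fy a by auto
        then show ?thesis unfolding Bmem using a by (intro exI[of _ 0]) simp
      qed
    qed
    \<comment> \<open>Every point of \<open>B\<close> already has a preimage in \<open>B\<close>, so
      injectivity keeps \<open>f\<close> from mapping outside points into \<open>B\<close>.\<close>
    have "f ` B = B" using endo_inj_surj[OF finB fB] inj_on_subset[OF inj BX] .
    have "\<exists>xs. (\<forall>(m, a)\<in>set xs. m \<in> X - B \<and> 0 < a \<and> ((f ^^ a) m = m \<or> (f ^^ a) m = - m)) \<and>
        (\<forall>y\<in>X - B. \<exists>(m, a)\<in>set xs. \<exists>r<a. y = (f ^^ r) m \<or> y = - (f ^^ r) m) \<and>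
        card (X - B) = 2 * sum_list (map snd xs)"
    proof (rule psubset.IH)
      have "x \<in> B" unfolding Bmem using a by (intro exI[of _ 0]) simp
      then show "X - B \<subset> X" using x by blast
      show "f ` (X - B) \<subseteq> X - B"
      proof clarify
        fix y assume y: "y \<in> X" "y \<notin> B"
        have "f y \<notin> B"
        proof
          assume "f y \<in> B"
          then obtain z where "z \<in> B" "f y = f z" using \<open>f ` B = B\<close> by blast
          then show False using inj_onD[OF inj, of y z] y BX by blast
        qed
        then show "f y \<in> X - B" using cl y by blast
      qed
      show "uminus ` (X - B) \<subseteq> X - B"
      proof clarify
        fix y assume y: "y \<in> X" "y \<notin> B"
        have "- y \<notin> B" using y(2) unfolding Bmem by (metis minus_minus)
        then show "- y \<in> X - B" using sym y by blast
      qed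
    qed (use inj psubset.prems(4) odd in \<open>auto intro: inj_on_subset\<close>)
    then obtain xs where
      xs0: "\<forall>(m, a)\<in>set xs. m \<in> X - B \<and> 0 < a \<and> ((f ^^ a) m = m \<or> (f ^^ a) m = - m)"
      and xs2: "\<forall>y\<in>X - B. \<exists>(m, a)\<in>set xs. \<exists>r<a. y = (f ^^ r) m \<or> y = - (f ^^ r) m"
      and xs3: "card (X - B) = 2 * sum_list (map snd xs)" by (elim exE conjE)
    have xs1: "m \<in> X - B \<and> 0 < a \<and> ((f ^^ a) m = m \<or> (f ^^ a) m = - m)" if "(m, a) \<in> set xs" for m a
      using bspec[OF xs0 that] by simp
    have "card X = card B + card (X - B)"
      using card_Diff_subset[OF finB BX] card_mono[OF psubset.hyps BX] by simp
    then have "card X = 2 * sum_list (map snd ((x, a) # xs))" using cardB xs3 by simp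
    moreover have "\<exists>(m, a)\<in>set ((x, a) # xs). \<exists>r<a. y = (f ^^ r) m \<or> y = - (f ^^ r) m" if "y \<in> X" for y
    proof (cases "y \<in> B")
      case True
      then show ?thesis using Bmem by auto
    next
      case False
      then show ?thesis using bspec[OF xs2, of y] that by auto
    qed
    ultimately show ?thesis using xs1 a x by (intro exI[of _ "(x, a) # xs"]) auto
  qed
qed

lemma sum_list_cong_mset: "mset xs = mset ys \<Longrightarrow> sum_list (map g xs) = sum_list (map g ys)"
  for g :: "'a \<Rightarrow> nat"
  by (metis mset_map sum_mset_sum_list)

text \<open>\<open>sort_key\<close> sorts increasingly, hence the negated length as key.\<close>

lemma sorted_snd_sort_key:
  "sorted_wrt (\<ge>) (map snd (sort_key (\<lambda>(m, a). - int a) xs))" for xs :: "('a \<times> nat) list"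
proof -
  have "sorted_wrt (\<lambda>x y. (case x of (m, a) \<Rightarrow> - int a) \<le> (case y of (m, a) \<Rightarrow> - int a))
      (sort_key (\<lambda>(m, a). - int a) xs)"
    using sorted_sort_key[of "\<lambda>(m, a). - int a" xs] by (simp add: sorted_wrt_map)
  then show ?thesis unfolding sorted_wrt_map by (rule sorted_wrt_mono_rel[rotated]) auto
qed

text \<open>The cycles of \<open>f\<close> are laid out as consecutive blocks, and
  \<open>\<gamma>\<close> sends the entry at offset \<open>r\<close> of block \<open>k\<close> to
  the r-th iterate of the chosen point of cycle \<open>k\<close>. Then a step of \<open>cyc\<close>
  in a block becomes a step of \<open>f\<close> along the cycle.\<close>

lemma cyc_normal_form:
  assumes f: "odd_bij n f"
  obtains lam rho \<gamma> where "maximal_split_partition n rho lam" "odd_bij n \<gamma>"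
    "\<And>x. x \<in> signed_ints n \<Longrightarrow> f (\<gamma> x) = \<gamma> (cyc lam rho x)"
proof -
  let ?I = "signed_ints n"
  have bij: "inj_on f ?I" "f ` ?I = ?I" and odd: "\<And>x. x \<in> ?I \<Longrightarrow> f (- x) = - f x"
    using f by (auto simp: odd_bij_def bij_betw_def)
  have "\<exists>xs. (\<forall>(m, a)\<in>set xs. m \<in> ?I \<and> 0 < a \<and> ((f ^^ a) m = m \<or> (f ^^ a) m = - m)) \<and>
    (\<forall>y\<in>?I. \<exists>(m, a)\<in>set xs. \<exists>r<a. y = (f ^^ r) m \<or> y = - (f ^^ r) m) \<and>
    card ?I = 2 * sum_list (map snd xs)"
    by (rule orbit_decomposition) (use bij odd finite_signed_ints signed_ints_uminus in \<open>auto simp: signed_ints_def\<close>)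
  then obtain xs where
      xs0: "\<forall>(m, a)\<in>set xs. m \<in> ?I \<and> 0 < a \<and> ((f ^^ a) m = m \<or> (f ^^ a) m = - m)"
      and xs2: "\<forall>y\<in>?I. \<exists>(m, a)\<in>set xs. \<exists>r<a. y = (f ^^ r) m \<or> y = - (f ^^ r) m"
      and xs3: "card ?I = 2 * sum_list (map snd xs)" by (elim exE conjE)
  have xs1: "m \<in> ?I \<and> 0 < a \<and> ((f ^^ a) m = m \<or> (f ^^ a) m = - m)" if "(m, a) \<in> set xs" for m a
      using bspec[OF xs0 that] by simp
  define pos where "pos = (\<lambda>(m, a). (f ^^ a) m = m)"
  let ?sort = "sort_key (\<lambda>(m, a). - int a) :: (int \<times> nat) list \<Rightarrow> (int \<times> nat) list"
  \<comment> \<open>Positive cycles come first, so that they occupy the blocks below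
    \<open>rho\<close>; sorting each group by length gives a maximal split partition.\<close>
  define ys where "ys = ?sort (filter pos xs) @ ?sort (filter (\<lambda>x. \<not> pos x) xs)"
  define rho where "rho = length (filter pos xs)"
  define lam where "lam = map snd ys"
  have set_ys: "set ys = set xs" by (auto simp: ys_def)
  have "card ?I = 2 * n"
  proof -
    have "?I = {- int n..-1} \<union> {1..int n}" by (auto simp: signed_ints_def)
    moreover have "card ({- int n..-1} \<union> {1..int n}) = 2 * n" by (subst card_Un_disjoint) auto
    ultimately show ?thesis by simp
  qed
  moreover have "mset ys = mset xs" by (simp add: ys_def)
  ultimately have sum: "sum_list lam = n"
    using xs3 sum_list_cong_mset[of ys xs snd] by (simp add: lam_def)
  have m: "length lam = length ys" by (simp add: lam_def)
  have part: "maximal_split_partition n rho lam"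
    unfolding maximal_split_partition_def is_partition_def
  proof (intro conjI)
    show "\<forall>x\<in>set lam. 0 < x" using xs1 set_ys by (auto simp: lam_def)
    show "rho \<le> length lam" by (simp add: m ys_def rho_def)
    have "take rho lam = map snd (?sort (filter pos xs))"
      "drop rho lam = map snd (?sort (filter (\<lambda>x. \<not> pos x) xs))"
      by (simp_all add: lam_def ys_def rho_def)
    then show "sorted_wrt (\<ge>) (take rho lam)" "sorted_wrt (\<ge>) (drop rho lam)"
      by (simp_all only: sorted_snd_sort_key)
  qed (rule sum)
  have yk: "(fst (ys ! k), lam ! k) \<in> set xs" if "k < length lam" for k
    using that set_ys nth_mem[of k ys] by (simp add: lam_def)
  have per: "(f ^^ (lam ! k)) (fst (ys ! k)) = cycle_sign rho k * fst (ys ! k)" if k: "k < length lam" for k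
  proof (cases "k < rho")
    case True
    then have "ys ! k \<in> set (filter pos xs)"
      using nth_mem[of k "?sort (filter pos xs)"] by (simp add: ys_def rho_def nth_append)
    then show ?thesis using True k by (auto simp: pos_def cycle_sign_def lam_def split: prod.splits)
  next
    case False
    then have "ys ! k \<in> set (filter (\<lambda>x. \<not> pos x) xs)"
      using k nth_mem[of "k - rho" "?sort (filter (\<lambda>x. \<not> pos x) xs)"]
      by (simp add: m) (simp add: ys_def rho_def nth_append split: if_splits)
    then have "\<not> pos (ys ! k)" by simp
    then show ?thesis using False k xs1[OF yk[OF k]]
      by (auto simp: pos_def cycle_sign_def lam_def split: prod.splits)
  qed
  \<comment> \<open>The exponent is the offset of the absolute value of \<open>p\<close> in its
    block, counted from 0; the factor \<open>sgn p\<close> makes \<open>\<gamma>\<close>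
    odd.\<close>
  define \<gamma> where "\<gamma> p = (let k = block lam (nat \<bar>p\<bar>) in
    sgn p * (f ^^ (nat \<bar>p\<bar> - start lam k - 1)) (fst (ys ! k)))" for p
  have fI: "(f ^^ r) x \<in> ?I" if "x \<in> ?I" for r x
    by (rule funpow_closed[OF _ that]) (use bij in simp)
  have fs: "f (sgn p * y) = sgn p * f y" if "p \<in> ?I" "y \<in> ?I" for p y
    using that odd by (auto simp: signed_ints_def sgn_if)
  have g_eq: "\<gamma> p = sgn p * (f ^^ r) (fst (ys ! k))"
    if "p \<in> block_set lam k" "\<bar>p\<bar> = int (start lam k + 1 + r)" for p k r
  proof -
    have "nat \<bar>p\<bar> - start lam k - 1 = r" unfolding that(2) nat_int by simp
    then show ?thesis unfolding \<gamma>_def block_of_block_set[OF that(1)] Let_def by simp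
  qed
  have pos_ex: "\<exists>k r. k < length lam \<and> r < lam ! k \<and> p \<in> block_set lam k \<and> \<bar>p\<bar> = int (start lam k + 1 + r)"
    if "p \<in> ?I" for p
  proof -
    let ?k = "block lam (nat \<bar>p\<bar>)"
    have k: "?k < length lam" "p \<in> block_set lam ?k" using signed_ints_block[of p lam] that sum by auto
    have "\<bar>p\<bar> = int (start lam ?k + 1 + nat (\<bar>p\<bar> - int (start lam ?k) - 1))"
      "nat (\<bar>p\<bar> - int (start lam ?k) - 1) < lam ! ?k"
      using k(2) start_Suc[OF k(1)] by (auto simp: block_set_def nat_less_iff)
    then show ?thesis using k by blast
  qed
  have mI: "fst (ys ! k) \<in> ?I" if "k < length lam" for k using xs1[OF yk[OF that]] by blast
  have odd_g: "\<gamma> (- p) = - \<gamma> p" for p by (simp add: \<gamma>_def Let_def)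
  \<comment> \<open>Every signed index lies, up to sign, on a listed cycle, which gives
    surjectivity; finiteness of \<open>?I\<close> will give injectivity.\<close>
  have "\<gamma> ` ?I = ?I"
  proof (intro equalityI subsetI)
    fix y assume "y \<in> \<gamma> ` ?I"
    then obtain p where p: "p \<in> ?I" "y = \<gamma> p" by blast
    from pos_ex[OF p(1)] obtain k r where "k < length lam" "p \<in> block_set lam k" "\<bar>p\<bar> = int (start lam k + 1 + r)"
      by blast
    then show "y \<in> ?I" using g_eq fI[OF mI] p by (auto simp: signed_ints_def sgn_if)
  next
    fix y assume "y \<in> ?I"
    from bspec[OF xs2 this] obtain m a r where ma: "(m, a) \<in> set ys" "r < a" "y = (f ^^ r) m \<or> y = - (f ^^ r) m"
      unfolding set_ys by blast
    obtain k where k: "k < length ys" "ys ! k = (m, a)" using ma(1) by (auto simp: in_set_conv_nth)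
    then have k: "k < length lam" "r < lam ! k" and y: "y = (f ^^ r) (fst (ys ! k)) \<or> y = - (f ^^ r) (fst (ys ! k))"
      using ma(2,3) by (simp_all add: lam_def)
    let ?p = "int (start lam k + 1 + r)"
    have p: "?p \<in> block_set lam k" using k start_Suc[OF k(1)] by (simp add: block_set_def)
    then have "?p \<in> ?I" using block_set_subset sum by blast
    have "\<gamma> ?p = (f ^^ r) (fst (ys ! k))" using g_eq[OF p, of r] by simp
    then have "y = \<gamma> ?p \<or> y = \<gamma> (- ?p)" using y by (simp only: odd_g)
    then show "y \<in> \<gamma> ` ?I" using \<open>?p \<in> ?I\<close> signed_ints_uminus by blast
  qed
  then have "bij_betw \<gamma> ?I ?I"
    using eq_card_imp_inj_on[of ?I \<gamma>] finite_signed_ints by (simp add: bij_betw_def)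
  then have g: "odd_bij n \<gamma>" by (simp add: odd_bij_def odd_g)
  have "f (\<gamma> p) = \<gamma> (cyc lam rho p)" if p: "p \<in> ?I" for p
  proof -
    from pos_ex[OF p] obtain k r where k: "k < length lam" "r < lam ! k"
      and b: "p \<in> block_set lam k" and r: "\<bar>p\<bar> = int (start lam k + 1 + r)" by blast
    have fg: "f (\<gamma> p) = sgn p * (f ^^ Suc r) (fst (ys ! k))"
      using g_eq[OF b r] fs[OF p fI[OF mI[OF k(1)]]] by simp
    note cb = cyc_block_set[OF b, of rho]
    show ?thesis
    proof (cases "Suc r < lam ! k")
      case True
      then have c: "cyc lam rho p = sgn p * (\<bar>p\<bar> + 1)" using r start_Suc[OF k(1)] by (simp add: cyc_eq[OF b])
      then have "\<bar>cyc lam rho p\<bar> = int (start lam k + 1 + Suc r)" "sgn (cyc lam rho p) = sgn p"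
        using r by (auto simp: abs_mult sgn_mult sgn_if)
      then show ?thesis using g_eq[OF cb, of "Suc r"] fg by simp
    next
      case False
      \<comment> \<open>At the end of a block \<open>cyc\<close> returns to the first entry with the
        cycle sign, and by \<open>per\<close> so does \<open>f\<close> to the chosen point.\<close>
      then have Sr: "Suc r = lam ! k" using k by simp
      then have c: "cyc lam rho p = sgn p * (cycle_sign rho k * (int (start lam k) + 1))"
        using r start_Suc[OF k(1)] by (simp add: cyc_eq[OF b])
      then have "\<bar>cyc lam rho p\<bar> = int (start lam k + 1 + 0)" "sgn (cyc lam rho p) = sgn p * cycle_sign rho k"
        using r cycle_sign_cases[of rho k] by (auto simp: abs_mult sgn_mult sgn_if)
      then have "\<gamma> (cyc lam rho p) = sgn p * cycle_sign rho k * fst (ys ! k)" using g_eq[OF cb, of 0] by simp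
      then show ?thesis using fg per[OF k(1)] unfolding Sr by simp
    qed
  qed
  then show ?thesis using that part g by blast
qed

section \<open>Representatives of the conjugacy classes and maximality of their lengths\<close>

lemma conj_type_B:
  assumes g: "g \<in> carrier (type_B n)"
  shows "inv\<^bsub>type_B n\<^esub> g \<in> carrier (type_B n)" "inv\<^bsub>type_B n\<^esub> g * g = 1\<^sub>m n" "inv\<^bsub>type_B n\<^esub> (inv\<^bsub>type_B n\<^esub> g) = g"
    "conj_action n g h = g * h * inv\<^bsub>type_B n\<^esub> g"
  using group.inv_closed[OF group_type_B g] group.l_inv[OF group_type_B g] group.inv_inv[OF group_type_B g]
  by (simp_all add: type_B_def conj_action_def)

lemma type_B_carrier_mat: "g \<in> carrier (type_B n) \<Longrightarrow> g \<in> carrier_mat n n"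
  by (simp add: type_B_def)

lemma cyc_odd_bij:
  assumes "\<forall>x\<in>set lam. 0 < x" "sum_list lam = n"
  shows "odd_bij n (cyc lam rho)"
proof -
  let ?I = "signed_ints n"
  have blk: "block lam (nat \<bar>x\<bar>) < length lam \<and> x \<in> block_set lam (block lam (nat \<bar>x\<bar>))" if "x \<in> ?I" for x
    using signed_ints_block[of x lam] that assms(2) by auto
  have sub: "cyc lam rho ` ?I \<subseteq> ?I"
    using blk cyc_block_set block_set_subset[of lam] assms(2) by blast
  have "inj_on (cyc lam rho) ?I"
  proof (rule inj_onI)
    fix x y assume h: "x \<in> ?I" "y \<in> ?I" "cyc lam rho x = cyc lam rho y"
    let ?k = "block lam (nat \<bar>x\<bar>)"
    have "?k = block lam (nat \<bar>y\<bar>)"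
      using block_of_block_set[OF cyc_block_set[OF conjunct2[OF blk[OF h(1)]]], of rho]
        block_of_block_set[OF cyc_block_set[OF conjunct2[OF blk[OF h(2)]]], of rho] h(3) by simp
    then have "x \<in> block_set lam ?k" "y \<in> block_set lam ?k" "?k < length lam"
      using blk[OF h(1)] blk[OF h(2)] by simp_all
    then show "x = y" using inj_onD[OF inj_on_cyc h(3)] assms(1) by simp
  qed
  then show ?thesis
    using sub endo_inj_surj[OF finite_signed_ints] by (simp add: odd_bij_def bij_betw_def cyc_odd)
qed

text \<open>The normal form is applied to the negative of \<open>A\<close>, because
  \<open>cyc\<close> describes the negative of \<open>w_elt\<close>. The two signs cancel, leaving
  \<open>A * G = G * W\<close> for the matrix \<open>G\<close> of \<open>\<gamma>\<close>, so that
  the inverse of \<open>G\<close> conjugates \<open>A\<close> to \<open>W\<close>.\<close>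

lemma conj_class_contains_w_elt:
  assumes A: "A \<in> carrier (type_B n)"
  shows "\<exists>lam rho. maximal_split_partition n rho lam \<and> w_elt n lam rho \<in> conj_class n A"
proof -
  obtain a where a: "odd_bij n a" and act: "\<forall>x\<in>signed_ints n. A *\<^sub>v signed_vec n x = signed_vec n (a x)"
    using type_B_action[OF A] by blast
  have "bij_betw (\<lambda>x. - a x) (signed_ints n) (signed_ints n)"
  proof -
    have "bij_betw uminus (signed_ints n) (signed_ints n)"
      by (rule bij_betw_byWitness[of _ uminus]) (auto simp: signed_ints_def)
    from bij_betw_trans[OF _ this, of a] show ?thesis using a by (simp add: odd_bij_def comp_def)
  qed
  then have "odd_bij n (\<lambda>x. - a x)" using a by (simp add: odd_bij_def)
  from cyc_normal_form[OF this] obtain lam rho \<gamma> where part: "maximal_split_partition n rho lam"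
    and g: "odd_bij n \<gamma>" and conj: "\<And>x. x \<in> signed_ints n \<Longrightarrow> - a (\<gamma> x) = \<gamma> (cyc lam rho x)"
    by metis
  have n: "sum_list lam = n" and pos: "\<forall>x\<in>set lam. 0 < x"
    using part by (auto simp: maximal_split_partition_def is_partition_def)
  define G W where "G = signed_mat n \<gamma>" and "W = w_elt n lam rho"
  have GB: "G \<in> carrier (type_B n)" unfolding G_def by (rule signed_mat_in_type_B[OF g])
  note c = conj_type_B[OF GB]
  have GM: "G \<in> carrier_mat n n" "A \<in> carrier_mat n n" "W \<in> carrier_mat n n" "inv\<^bsub>type_B n\<^esub> G \<in> carrier_mat n n"
    using type_B_carrier_mat GB A c(1) w_elt_action(1)[OF n] by (auto simp: W_def)
  have "A * G = G * W"
  proof (rule signed_mat_eqI)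
    fix x assume x: "x \<in> signed_ints n"
    have cx: "cyc lam rho x \<in> signed_ints n" using odd_bijD(1)[OF cyc_odd_bij[OF pos n] x] .
    have "A * G *\<^sub>v signed_vec n x = A *\<^sub>v (G *\<^sub>v signed_vec n x)"
      by (rule assoc_mult_mat_vec) (use GM in auto)
    also have "\<dots> = signed_vec n (a (\<gamma> x))"
      using act odd_bijD(1)[OF g x] by (simp add: G_def signed_mat_action[OF g x])
    also have "a (\<gamma> x) = \<gamma> (- cyc lam rho x)" using conj[OF x] odd_bijD(2)[OF g cx] by simp
    also have "signed_vec n (\<gamma> (- cyc lam rho x)) = G *\<^sub>v (W *\<^sub>v signed_vec n x)"
      unfolding W_def w_elt_action(2)[OF n x] G_def
      by (rule signed_mat_action[OF g signed_ints_uminus[OF cx], symmetric])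
    also have "\<dots> = G * W *\<^sub>v signed_vec n x"
      by (rule assoc_mult_mat_vec[symmetric]) (use GM in auto)
    finally show "A * G *\<^sub>v signed_vec n x = G * W *\<^sub>v signed_vec n x" .
  qed (use GM in auto)
  then have "inv\<^bsub>type_B n\<^esub> G * A * G = W"
    using GM c(2) by (simp add: assoc_mult_mat[of _ n n _ n _ n] flip: assoc_mult_mat[of "inv\<^bsub>type_B n\<^esub> G" n n G n W n])
  then have "W = conj_action n (inv\<^bsub>type_B n\<^esub> G) A" using conj_type_B(4)[OF c(1)] c(3) by simp
  then have "W \<in> conj_class n A" unfolding conj_class_def orbit_def using c(1) by blast
  then show ?thesis using part by (auto simp: W_def)
qed

text \<open>By \<open>card_roots_conj\<close>, inverted roots and flips together make up all
  positive roots of the given kind, both for \<open>v\<close> and for \<open>w_elt\<close>. Fewer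
  flips therefore mean more inverted roots. Long and short roots are kept apart because the D-length
  counts long ones only.\<close>

lemma length_le_w_elt:
  assumes part: "maximal_split_partition n rho lam" and v: "v \<in> conj_class n (w_elt n lam rho)"
  shows "card (Lambda n v) \<le> card (Lambda n (w_elt n lam rho))"
    "card (Sigma_short n v) \<le> card (Sigma_short n (w_elt n lam rho))"
proof -
  let ?W = "w_elt n lam rho" and ?f = "cyc lam rho" and ?I = "signed_ints n"
  have n: "sum_list lam = n" and pos: "\<forall>x\<in>set lam. 0 < x" and sorted: "sorted_wrt (\<ge>) (drop rho lam)"
    using part by (auto simp: maximal_split_partition_def is_partition_def)
  note f = cyc_odd_bij[OF pos n, of rho] and W = w_elt_action(1)[OF n, of rho] w_elt_action(2)[OF n, of _ rho]
  obtain g where g: "g \<in> carrier (type_B n)" "v = conj_action n g ?W"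
    using v by (auto simp: conj_class_def orbit_def)
  note c = conj_type_B[OF g(1)]
  have M: "g \<in> carrier_mat n n" "inv\<^bsub>type_B n\<^esub> g \<in> carrier_mat n n"
    using type_B_carrier_mat g(1) c(1) by auto
  obtain \<gamma> where \<gamma>: "odd_bij n \<gamma>" and act: "\<forall>x\<in>?I. g *\<^sub>v signed_vec n x = signed_vec n (\<gamma> x)"
    using type_B_action[OF g(1)] by blast
  have vW: "v = g * ?W * inv\<^bsub>type_B n\<^esub> g" using g(2) c(4) by simp
  then have vM: "v \<in> carrier_mat n n" using M W(1) by auto
  have "v * g = g * ?W"
    using M W(1) c(2) unfolding vW by (simp add: assoc_mult_mat[of _ n n _ n _ n])
  have conj: "v *\<^sub>v signed_vec n (\<gamma> x) = signed_vec n (- \<gamma> (?f x))" if x: "x \<in> ?I" for x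
  proof -
    have fx: "?f x \<in> ?I" by (rule odd_bijD(1)[OF f x])
    have "v *\<^sub>v signed_vec n (\<gamma> x) = v * g *\<^sub>v signed_vec n x"
      using act x assoc_mult_mat_vec[OF vM M(1) signed_vec_carrier] by simp
    also have "\<dots> = g *\<^sub>v (?W *\<^sub>v signed_vec n x)"
      unfolding \<open>v * g = g * ?W\<close> by (rule assoc_mult_mat_vec[OF M(1) W(1) signed_vec_carrier])
    also have "\<dots> = signed_vec n (- \<gamma> (?f x))"
      using act signed_ints_uminus[OF fx] W(2)[OF x] odd_bijD(2)[OF \<gamma> fx] by simp
    finally show ?thesis .
  qed
  have id: "odd_bij n (\<lambda>x. x)" by (simp add: odd_bij_def bij_betw_def)
  \<comment> \<open>For \<open>w_elt\<close> itself the conjugating permutation is the identity, so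
    \<open>G\<close> becomes the height itself.\<close>
  note cv = card_roots_conj[OF vM \<gamma> f conj] and cW = card_roots_conj[OF W(1) id f W(2)]
  note min = cyc_flips_minimal[OF pos n sorted, of "\<lambda>x. height n (\<gamma> x)"]
  have h1: "height n (\<gamma> (- x)) = - height n (\<gamma> x)" "height n (\<gamma> x) \<noteq> 0" if "x \<in> ?I" for x
    using odd_bijD[OF \<gamma> that] height_nz by (auto simp: height_uminus)
  have h2: "\<bar>x\<bar> = \<bar>y\<bar>" if "x \<in> ?I" "y \<in> ?I" "\<bar>height n (\<gamma> x)\<bar> = \<bar>height n (\<gamma> y)\<bar>" for x y
    using odd_bij_abs_inj[OF \<gamma> that(1,2)] height_abs_inj that(3) odd_bijD(1)[OF \<gamma> that(1)] odd_bijD(1)[OF \<gamma> that(2)]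
    by blast
  let ?D = "\<lambda>G. card {(p, q) \<in> flips ?f G ?I ?I. \<bar>p\<bar> < \<bar>q\<bar>}"
    and ?S = "\<lambda>G. card {p \<in> ?I. 0 < G p \<and> G (?f p) < 0}"
  have "card (Lambda n v) + ?D (\<lambda>x. height n (\<gamma> x)) = card (Lambda n ?W) + ?D (height n)"
    by (rule trans[OF cv(1) cW(1)[symmetric]])
  moreover have "?D (height n) \<le> ?D (\<lambda>x. height n (\<gamma> x))" by (rule min(1)[OF h1 h2])
  ultimately show "card (Lambda n v) \<le> card (Lambda n ?W)" by linarith
  have "card (Sigma_short n v) + ?S (\<lambda>x. height n (\<gamma> x)) = card (Sigma_short n ?W) + ?S (height n)"
    by (rule trans[OF cv(2) cW(2)[symmetric]])
  moreover have "?S (height n) \<le> ?S (\<lambda>x. height n (\<gamma> x))" by (rule min(2)[OF h1 h2])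
  ultimately show "card (Sigma_short n v) \<le> card (Sigma_short n ?W)" by linarith
qed

theorem theorem1p2:
  fixes n :: nat
  shows "(\<forall>C \<in> conj_classes n. \<exists>lam rho. maximal_split_partition n rho lam \<and> w_elt n lam rho \<in> C) \<and>
    (\<forall>lam rho. maximal_split_partition n rho lam \<longrightarrow>
      (\<forall>v \<in> conj_class n (w_elt n lam rho).
         B_length n v \<le> B_length n (w_elt n lam rho) \<and>
         D_length n v \<le> D_length n (w_elt n lam rho)))"
proof (intro conjI ballI allI impI)
  fix C assume "C \<in> conj_classes n"
  then obtain A where A: "A \<in> carrier (type_B n)" "C = conj_class n A"
    by (auto simp: conj_classes_def orbits_def conj_class_def)
  show "\<exists>lam rho. maximal_split_partition n rho lam \<and> w_elt n lam rho \<in> C"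
    unfolding A(2) by (rule conj_class_contains_w_elt[OF A(1)])
next
  fix lam rho v assume "maximal_split_partition n rho lam" "v \<in> conj_class n (w_elt n lam rho)"
  note le = length_le_w_elt[OF this]
  show "B_length n v \<le> B_length n (w_elt n lam rho)" unfolding B_length_def by (rule add_mono[OF le])
  show "D_length n v \<le> D_length n (w_elt n lam rho)" unfolding D_length_def by (rule le(1))
qed

end
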